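(* For any $\alpha \in (0,2]$ there exists a constant $C_\alpha>0$ depending only on $\alpha$ such that the following holds. Let $X_1, \ldots, X_n$ be independent real random variables with $\lVert X_i\rVert_{\Psi_\alpha} < \infty$ for every $i$, let $X=(X_1,\ldots,X_n)$, and let $f \colon \mathbb{R}^n \to \mathbb{R}$ be convex and $1$-Lipschitz (with respect to the Euclidean norm). Then, for any $t \ge 0$, $$\mathbb{P}(|f(X) - \mathbb{E}f(X)| > t) \le 2 \exp\Big(-\frac{t^\alpha}{C_\alpha\lVert \max_i |X_i| \rVert_{\Psi_\alpha}^\alpha}\Big).$$ In particular, $$\lVert f(X) - \mathbb{E}f(X) \rVert_{\Psi_\alpha} \le C_\alpha \lVert \max_i |X_i| \rVert_{\Psi_\alpha}$$ (where the constant $C_\alpha$ may differ from the previous one, but again depends only on $\alpha$).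
   Context: For a real random variable $X$ and $\alpha>0$, the Orlicz (quasi-)norm is $\lVert X \rVert_{\Psi_\alpha} := \inf \{t > 0 : \mathbb{E} \exp ((|X|/t)^\alpha) \le 2 \}$. The constants $C_\alpha$ do not depend on $n$, $f$, $t$ or the distributions of the $X_i$. *)

theory Defs
  imports "HOL-Probability.Probability"
begin

text \<open>The expectation is a nonnegative integral and the infimum is taken in \<open>ennreal\<close>, so the
  value is \<open>\<infinity>\<close> exactly if no \<open>t\<close> is admissible.\<close>

definition orlicz_norm :: "real \<Rightarrow> 'a measure \<Rightarrow> ('a \<Rightarrow> real) \<Rightarrow> ennreal" where
  "orlicz_norm \<alpha> M Y =
     Inf (ennreal ` {t. 0 < t \<and> (\<integral>\<^sup>+ \<omega>. ennreal (exp ((\<bar>Y \<omega>\<bar> / t) powr \<alpha>)) \<partial>M) \<le> 2})"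

text \<open>The dimension \<open>n\<close> has to be quantified inside the scope of the constant, so \<open>\<real>\<^sup>n\<close> is rendered
  as the carrier of extensional functions on \<open>{..<n}\<close> (this is \<open>space (PiM {..<n} (\<lambda>_. borel))\<close>),
  with coordinates numbered from \<open>0\<close>.\<close>

definition Rn :: "nat \<Rightarrow> (nat \<Rightarrow> real) set" where
  "Rn n = {..<n} \<rightarrow>\<^sub>E UNIV"

definition convex_Rn :: "nat \<Rightarrow> ((nat \<Rightarrow> real) \<Rightarrow> real) \<Rightarrow> bool" where
  "convex_Rn n f \<longleftrightarrow>
     (\<forall>x\<in>Rn n. \<forall>y\<in>Rn n. \<forall>u\<in>{0..1}.
        f (\<lambda>i\<in>{..<n}. (1 - u) * x i + u * y i) \<le> (1 - u) * f x + u * f y)"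

definition lipschitz1_Rn :: "nat \<Rightarrow> ((nat \<Rightarrow> real) \<Rightarrow> real) \<Rightarrow> bool" where
  "lipschitz1_Rn n f \<longleftrightarrow>
     (\<forall>x\<in>Rn n. \<forall>y\<in>Rn n. \<bar>f x - f y\<bar> \<le> L2_set (\<lambda>i. x i - y i) {..<n})"

definition random_vector :: "nat \<Rightarrow> (nat \<Rightarrow> 'a \<Rightarrow> real) \<Rightarrow> 'a \<Rightarrow> (nat \<Rightarrow> real)" where
  "random_vector n X \<omega> = (\<lambda>i\<in>{..<n}. X i \<omega>)"

definition max_abs :: "nat \<Rightarrow> (nat \<Rightarrow> 'a \<Rightarrow> real) \<Rightarrow> 'a \<Rightarrow> real" where
  "max_abs n X \<omega> = Max ((\<lambda>i. \<bar>X i \<omega>\<bar>) ` {..<n})"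

definition centered :: "'a measure \<Rightarrow> ('a \<Rightarrow> real) \<Rightarrow> 'a \<Rightarrow> real" where
  "centered M Y \<omega> = Y \<omega> - (\<integral>\<omega>'. Y \<omega>' \<partial>M)"

text \<open>\<open>indep_vars\<close> includes the measurability of the \<open>X i\<close>.\<close>

definition admissible ::
  "real \<Rightarrow> 'a measure \<Rightarrow> nat \<Rightarrow> (nat \<Rightarrow> 'a \<Rightarrow> real) \<Rightarrow> ((nat \<Rightarrow> real) \<Rightarrow> real) \<Rightarrow> bool" where
  "admissible \<alpha> M n X f \<longleftrightarrow>
     prob_space M \<and> 1 \<le> n \<and>
     prob_space.indep_vars M (\<lambda>_. borel) X {..<n} \<and>
     (\<forall>i<n. orlicz_norm \<alpha> M (X i) < \<infinity>) \<and>
     convex_Rn n f \<and> lipschitz1_Rn n f"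

text \<open>The right-hand side of the tail inequality. If the norm \<open>K\<close> is \<open>0\<close>, the exponent of the bound
  is \<open>-\<infinity>\<close> and the bound is \<open>0\<close>, whereas HOL's \<open>x / 0 = 0\<close> would turn it into \<open>2\<close>. The
  norm \<open>K\<close> to which this is applied is finite for admissible data.\<close>

definition tail_rhs :: "real \<Rightarrow> real \<Rightarrow> ennreal \<Rightarrow> real \<Rightarrow> real" where
  "tail_rhs \<alpha> C K t =
     (if K = 0 then 0 else 2 * exp (- (t powr \<alpha> / (C * enn2real K powr \<alpha>))))"

text \<open>The type argument of the next two predicates is the type of the sample space.
  A HOL formula cannot quantify over the type of the sample space below \<open>\<exists>C\<close>, and in
  \<open>\<exists>C>0. tail_constant TYPE('a) \<alpha> C\<close> the constant could still depend on \<open>'a\<close>. To express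
  that it depends on \<open>\<alpha>\<close> only, the theorem chooses the constant for one fixed sample space type,
  \<open>nat \<Rightarrow> real\<close>, and asserts that each constant valid there is valid for the arbitrary type
  \<open>'a\<close>. Together the two conjuncts say that a single constant serves all probability spaces.\<close>

definition tail_constant :: "'a itself \<Rightarrow> real \<Rightarrow> real \<Rightarrow> bool" where
  "tail_constant (_ :: 'a itself) \<alpha> C \<longleftrightarrow>
     (\<forall>(M :: 'a measure) n X f t. admissible \<alpha> M n X f \<longrightarrow> 0 \<le> t \<longrightarrow>
        measure M {\<omega> \<in> space M. \<bar>centered M (\<lambda>\<omega>'. f (random_vector n X \<omega>')) \<omega>\<bar> > t}
          \<le> tail_rhs \<alpha> C (orlicz_norm \<alpha> M (max_abs n X)) t)"

definition norm_constant :: "'a itself \<Rightarrow> real \<Rightarrow> real \<Rightarrow> bool" where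
  "norm_constant (_ :: 'a itself) \<alpha> C \<longleftrightarrow>
     (\<forall>(M :: 'a measure) n X f. admissible \<alpha> M n X f \<longrightarrow>
        orlicz_norm \<alpha> M (centered M (\<lambda>\<omega>. f (random_vector n X \<omega>)))
          \<le> ennreal C * orlicz_norm \<alpha> M (max_abs n X))"

end

theory Submission
  imports Defs
begin

text \<open>Maurey's infimal convolution argument gives the bounded case without medians. For
  \<open>Q f x = inf\<^sub>y (f y + c * \<bar>x - y\<bar>\<^sup>2)\<close>, a product of probability measures on intervals of length \<open>D\<close>
  with \<open>c * D\<^sup>2 \<le> 1/8\<close>, and a convex Lipschitz function \<open>f\<close>, one has
  \<open>(\<integral> exp (Q f)) * (\<integral> exp (- f)) \<le> 1\<close>. Applied to \<open>l * (F - \<integral> F)\<close> for a convex 1-Lipschitz \<open>F\<close>, on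
  which \<open>Q\<close> decreases the value by at most \<open>l\<^sup>2 / (4 * c)\<close>, it bounds the exponential moments of both
  signs, because the other factor is at least \<open>1\<close> by Jensen's inequality.

  Unbounded variables are truncated at a level \<open>b\<close> with \<open>P (max \<bar>X\<^sub>i\<bar> \<le> b) \<ge> 1/2\<close>. The error is at
  most the Euclidean norm \<open>W\<close> of the exceedances, and since \<open>\<alpha> / 2 \<le> 1\<close>, \<open>W\<^sup>\<alpha>\<close> is at most the sum of
  their \<open>\<alpha>\<close>-th powers. By independence the exponential moment of this sum is a product,
  which is bounded because the sum of the exceedance moments is at most twice the moment of the maximum.

  This bounds the Orlicz norm of \<open>f X - E f X\<close>; the tail inequality follows from it by Markov's
  inequality.\<close>

section \<open>Infimal convolution of convex Lipschitz functions\<close>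

text \<open>The domain is all of \<open>nat \<Rightarrow> real\<close>. The Lipschitz bound sees
  only the coordinates below \<open>n\<close>, so two points agreeing there have the same value;
  updates such as \<open>x(n := r)\<close> and integration over finite products then need no
  restriction.\<close>

definition convex_lipschitz :: "nat \<Rightarrow> real \<Rightarrow> ((nat \<Rightarrow> real) \<Rightarrow> real) \<Rightarrow> bool" where
  "convex_lipschitz n L f \<longleftrightarrow>
     (\<forall>x y. \<forall>u\<in>{0..1}. f (\<lambda>i. (1 - u) * x i + u * y i) \<le> (1 - u) * f x + u * f y) \<and>
     (\<forall>x y. \<bar>f x - f y\<bar> \<le> L * L2_set (\<lambda>i. x i - y i) {..<n})"

lemma convex_lipschitzD:
  assumes "convex_lipschitz n L f"
  shows "u \<in> {0..1} \<Longrightarrow> f (\<lambda>i. (1 - u) * x i + u * y i) \<le> (1 - u) * f x + u * f y"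
    and "\<bar>f x - f y\<bar> \<le> L * L2_set (\<lambda>i. x i - y i) {..<n}"
  using assms unfolding convex_lipschitz_def by auto

definition inf_conv :: "nat \<Rightarrow> real \<Rightarrow> ((nat \<Rightarrow> real) \<Rightarrow> real) \<Rightarrow> (nat \<Rightarrow> real) \<Rightarrow> real" where
  "inf_conv n c f x = (INF y. f y + c * (\<Sum>i<n. (x i - y i)\<^sup>2))"

text \<open>Completing the square in the distance. This yields both the finiteness of the infimal
  convolution and the bound on how far it lies below \<open>f\<close>.\<close>

lemma lipschitz_plus_quadratic_ge:
  assumes "0 < c" and lip: "\<And>x y. \<bar>f x - f y\<bar> \<le> L * L2_set (\<lambda>i. x i - y i) {..<n}"
  shows "f x - L\<^sup>2 / (4 * c) \<le> f y + c * (\<Sum>i<n. (x i - y i)\<^sup>2)"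
proof -
  define d where "d = L2_set (\<lambda>i. x i - y i) {..<n}"
  have d2: "d\<^sup>2 = (\<Sum>i<n. (x i - y i)\<^sup>2)"
    unfolding d_def L2_set_def by (simp add: sum_nonneg)
  have "0 \<le> (2 * c * d - L)\<^sup>2 / (4 * c)" using assms by simp
  also have "\<dots> = c * d\<^sup>2 - L * d + L\<^sup>2 / (4 * c)"
    using assms(1) by (simp add: field_simps power2_eq_square)
  finally show ?thesis using lip[of x y] unfolding d2[symmetric] d_def[symmetric] by linarith
qed

lemma inf_conv_bdd_below:
  assumes "0 < c" and "convex_lipschitz n L f"
  shows "bdd_below (range (\<lambda>y. f y + c * (\<Sum>i<n. (x i - y i)\<^sup>2)))"
  using lipschitz_plus_quadratic_ge[OF assms(1) convex_lipschitzD(2)[OF assms(2)]]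
  by (intro bdd_belowI[of _ "f x - L\<^sup>2 / (4 * c)"]) auto

lemma inf_conv_le:
  assumes "0 < c" and "convex_lipschitz n L f"
  shows "inf_conv n c f x \<le> f y + c * (\<Sum>i<n. (x i - y i)\<^sup>2)"
  unfolding inf_conv_def by (intro cINF_lower inf_conv_bdd_below[OF assms]) simp

lemma inf_conv_ge:
  assumes "0 < c" and "convex_lipschitz n L f"
  shows "f x - L\<^sup>2 / (4 * c) \<le> inf_conv n c f x"
  unfolding inf_conv_def
  by (intro cINF_greatest lipschitz_plus_quadratic_ge assms convex_lipschitzD(2)[OF assms(2)]) auto

lemma inf_conv_mono:
  assumes "0 < c" "convex_lipschitz n L f" and "\<And>y. f y \<le> g y + d"
  shows "inf_conv n c f x \<le> inf_conv n c g x + d"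
proof -
  have "inf_conv n c f x - d \<le> inf_conv n c g x"
    unfolding inf_conv_def[of n c g]
  proof (intro cINF_greatest)
    fix y show "inf_conv n c f x - d \<le> g y + c * (\<Sum>i<n. (x i - y i)\<^sup>2)"
      using inf_conv_le[OF assms(1,2), of x y] assms(3)[of y] by linarith
  qed simp
  then show ?thesis by simp
qed

lemma square_mix_le:
  fixes p q u :: real
  assumes "u \<in> {0..1}"
  shows "((1 - u) * p + u * q)\<^sup>2 \<le> (1 - u) * p\<^sup>2 + u * q\<^sup>2"
proof -
  have "0 \<le> u * (1 - u) * (p - q)\<^sup>2" using assms by simp
  also have "\<dots> = (1 - u) * p\<^sup>2 + u * q\<^sup>2 - ((1 - u) * p + u * q)\<^sup>2"
    by (simp add: power2_eq_square algebra_simps)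
  finally show ?thesis by simp
qed

lemma inf_conv_mix:
  assumes c: "0 < c" and lip: "convex_lipschitz n L f1" "convex_lipschitz n L f2"
      "convex_lipschitz n L f3"
    and u: "u \<in> {0..1}"
    and mix: "\<And>y z. f3 (\<lambda>i. (1 - u) * y i + u * z i) \<le> (1 - u) * f1 y + u * f2 z"
  shows "inf_conv n c f3 (\<lambda>i. (1 - u) * x1 i + u * x2 i)
     \<le> (1 - u) * inf_conv n c f1 x1 + u * inf_conv n c f2 x2"
\<comment> \<open>The infima need not be attained, hence the slack \<open>e\<close> in the choice of
  \<open>y\<close> and \<open>z\<close>.\<close>
proof (rule field_le_epsilon)
  fix e :: real assume e: "0 < e"
  let ?g1 = "\<lambda>y. f1 y + c * (\<Sum>i<n. (x1 i - y i)\<^sup>2)"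
  let ?g2 = "\<lambda>y. f2 y + c * (\<Sum>i<n. (x2 i - y i)\<^sup>2)"
  have "\<exists>y\<in>range ?g1. y < inf_conv n c f1 x1 + e"
    using cInf_lessD[of "range ?g1" "inf_conv n c f1 x1 + e"] e by (auto simp: inf_conv_def)
  then obtain y where y: "?g1 y < inf_conv n c f1 x1 + e" by auto
  have "\<exists>y\<in>range ?g2. y < inf_conv n c f2 x2 + e"
    using cInf_lessD[of "range ?g2" "inf_conv n c f2 x2 + e"] e by (auto simp: inf_conv_def)
  then obtain z where z: "?g2 z < inf_conv n c f2 x2 + e" by auto
  let ?x = "\<lambda>i. (1 - u) * x1 i + u * x2 i" and ?y = "\<lambda>i. (1 - u) * y i + u * z i"
  have "(?x i - ?y i)\<^sup>2 \<le> (1 - u) * (x1 i - y i)\<^sup>2 + u * (x2 i - z i)\<^sup>2" for i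
    using square_mix_le[OF u, of "x1 i - y i" "x2 i - z i"] by (simp add: algebra_simps)
  then have "(\<Sum>i<n. (?x i - ?y i)\<^sup>2)
      \<le> (\<Sum>i<n. (1 - u) * (x1 i - y i)\<^sup>2 + u * (x2 i - z i)\<^sup>2)"
    by (intro sum_mono)
  also have "\<dots> = (1 - u) * (\<Sum>i<n. (x1 i - y i)\<^sup>2) + u * (\<Sum>i<n. (x2 i - z i)\<^sup>2)"
    by (simp add: sum.distrib sum_distrib_left)
  finally have sq: "c * (\<Sum>i<n. (?x i - ?y i)\<^sup>2)
      \<le> c * ((1 - u) * (\<Sum>i<n. (x1 i - y i)\<^sup>2) + u * (\<Sum>i<n. (x2 i - z i)\<^sup>2))"
    using c by (intro mult_left_mono) auto
  have "inf_conv n c f3 ?x \<le> f3 ?y + c * (\<Sum>i<n. (?x i - ?y i)\<^sup>2)"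
    by (rule inf_conv_le[OF c lip(3)])
  also have "\<dots> \<le> (1 - u) * ?g1 y + u * ?g2 z"
    using sq mix[of y z] by (simp add: algebra_simps)
  also have "\<dots> \<le> (1 - u) * (inf_conv n c f1 x1 + e) + u * (inf_conv n c f2 x2 + e)"
    using mult_left_mono[OF less_imp_le[OF y], of "1 - u"]
      mult_left_mono[OF less_imp_le[OF z], of u] u by simp
  also have "\<dots> = (1 - u) * inf_conv n c f1 x1 + u * inf_conv n c f2 x2 + e"
    by (simp add: algebra_simps)
  finally show "inf_conv n c f3 ?x
      \<le> (1 - u) * inf_conv n c f1 x1 + u * inf_conv n c f2 x2 + e" .
qed

lemma convex_lipschitz_inf_conv:
  assumes c: "0 < c" and f: "convex_lipschitz n L f"
  shows "convex_lipschitz n L (inf_conv n c f)"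
proof -
  have *: "inf_conv n c f x - L * L2_set (\<lambda>i. x i - x' i) {..<n} \<le> inf_conv n c f x'" for x x'
    unfolding inf_conv_def[of n c f x']
  proof (intro cINF_greatest)
    fix y
    \<comment> \<open>Translating the competitor along with the point leaves the quadratic cost
      unchanged.\<close>
    let ?y = "\<lambda>i. y i + (x i - x' i)"
    have "inf_conv n c f x \<le> f ?y + c * (\<Sum>i<n. (x i - ?y i)\<^sup>2)"
      by (rule inf_conv_le[OF c f])
    also have "\<dots> \<le> f y + L * L2_set (\<lambda>i. x i - x' i) {..<n} + c * (\<Sum>i<n. (x' i - y i)\<^sup>2)"
      using convex_lipschitzD(2)[OF f, of ?y y] by (simp add: power2_commute)
    finally show "inf_conv n c f x - L * L2_set (\<lambda>i. x i - x' i) {..<n}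
        \<le> f y + c * (\<Sum>i<n. (x' i - y i)\<^sup>2)" by simp
  qed simp
  have sym: "L2_set (\<lambda>i. x i - x' i) {..<n} = L2_set (\<lambda>i. x' i - x i) {..<n}"
    for x x' :: "nat \<Rightarrow> real"
    by (simp add: L2_set_def power2_commute)
  have "\<bar>inf_conv n c f x - inf_conv n c f x'\<bar> \<le> L * L2_set (\<lambda>i. x i - x' i) {..<n}" for x x'
    using *[of x x'] *[of x' x] sym[of x x'] by simp
  then show ?thesis
    using inf_conv_mix[OF c f f f] convex_lipschitzD(1)[OF f] unfolding convex_lipschitz_def by auto
qed

lemma convex_lipschitz_section:
  assumes "convex_lipschitz (Suc n) L f"
  shows "convex_lipschitz n L (\<lambda>x. f (x(n := r)))"
proof -
  have eq: "(\<lambda>i. (1 - u) * x i + u * y i)(n := r) =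
      (\<lambda>i. (1 - u) * (x(n := r)) i + u * (y(n := r)) i)" for u x y
    by (auto simp: fun_eq_iff algebra_simps)
  have "f ((\<lambda>i. (1 - u) * x i + u * y i)(n := r))
      \<le> (1 - u) * f (x(n := r)) + u * f (y(n := r))" if "u \<in> {0..1}" for u x y
    unfolding eq using convex_lipschitzD(1)[OF assms that] .
  moreover have "L2_set (\<lambda>i. (x(n := r)) i - (y(n := r)) i) {..<Suc n}
      = L2_set (\<lambda>i. x i - y i) {..<n}" for x y
    by (simp add: L2_set_def)
  ultimately show ?thesis
    using convex_lipschitzD(2)[OF assms, of "_(n := r)" "_(n := r)"]
    unfolding convex_lipschitz_def by simp
qed

lemma inf_conv_section:
  assumes c: "0 < c" and f: "convex_lipschitz (Suc n) L f"
  shows "inf_conv (Suc n) c f (x(n := s))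
     \<le> inf_conv n c (\<lambda>x. f (x(n := r))) x + c * (s - r)\<^sup>2"
proof -
  have "inf_conv (Suc n) c f (x(n := s)) - c * (s - r)\<^sup>2 \<le> inf_conv n c (\<lambda>x. f (x(n := r))) x"
    unfolding inf_conv_def[of n]
  proof (intro cINF_greatest)
    fix y
    show "inf_conv (Suc n) c f (x(n := s)) - c * (s - r)\<^sup>2
        \<le> f (y(n := r)) + c * (\<Sum>i<n. (x i - y i)\<^sup>2)"
      using inf_conv_le[OF c f, of "x(n := s)" "y(n := r)"] by (simp add: algebra_simps)
  qed simp
  then show ?thesis by simp
qed

section \<open>Measurability of Lipschitz functions\<close>

lemma measurable_lipschitz:
  fixes n :: nat and f :: "(nat \<Rightarrow> real) \<Rightarrow> real"
  assumes lip: "\<And>x y. \<bar>f x - f y\<bar> \<le> L * L2_set (\<lambda>i. x i - y i) {..<n}"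
  shows "f \<in> borel_measurable (PiM {..<n} (\<lambda>_. borel :: real measure))"
proof -
  \<comment> \<open>In the product topology the finitely many coordinates below \<open>n\<close>
    converge, so the Euclidean distance over them tends to 0.\<close>
  have "continuous_on UNIV f"
    unfolding continuous_on_def
  proof
    fix x :: "nat \<Rightarrow> real"
    have *: "((\<lambda>y. y i - x i) \<longlongrightarrow> x i - x i) (at x)" for i
      by (intro tendsto_intros tendsto_at_iff_tendsto_nhds[THEN iffD2])
         (metis UNIV_I continuous_on_def continuous_on_product_coordinates
            tendsto_at_iff_tendsto_nhds)
    have "((\<lambda>y. L * L2_set (\<lambda>i. y i - x i) {..<n}) \<longlongrightarrow>
        L * sqrt (\<Sum>i<n. (x i - x i)\<^sup>2)) (at x)"
      unfolding L2_set_def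
      by (intro tendsto_mult_left tendsto_real_sqrt tendsto_sum tendsto_power *)
    then have "((\<lambda>y. L * L2_set (\<lambda>i. y i - x i) {..<n}) \<longlongrightarrow> 0) (at x)" by simp
    then have "((\<lambda>y. f y - f x) \<longlongrightarrow> 0) (at x)"
      by (rule Lim_null_comparison[rotated]) (use lip in auto)
    then show "(f \<longlongrightarrow> f x) (at x)" by (simp add: LIM_zero_iff)
  qed
  then have f: "f \<in> borel_measurable (PiM UNIV (\<lambda>_. borel))"
    using measurable_cong_sets[OF sets_PiM_equal_borel refl] borel_measurable_continuous_onI by blast
  \<comment> \<open>Padding with zeros passes from the product over \<open>{..<n}\<close> to the one
    over all indices; \<open>f\<close> does not notice the padding.\<close>
  have "(\<lambda>x i. if i < n then x i else 0) \<in>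
      measurable (PiM {..<n} (\<lambda>_. borel :: real measure)) (PiM UNIV (\<lambda>_. borel))"
  proof (rule measurable_PiM_single')
    show "(\<lambda>x. if i < n then x i else 0) \<in>
        measurable (PiM {..<n} (\<lambda>_. borel :: real measure)) borel" for i
      by (cases "i < n") auto
  qed (auto simp: space_PiM)
  from measurable_compose[OF this f]
  have "(\<lambda>x. f (\<lambda>i. if i < n then x i else 0)) \<in> borel_measurable (PiM {..<n} (\<lambda>_. borel))" .
  moreover have "f (\<lambda>i. if i < n then x i else 0) = f x" for x
    using lip[of "\<lambda>i. if i < n then x i else 0" x] by (simp add: L2_set_def)
  ultimately show ?thesis by simp
qed

section \<open>Maurey's inequality for product measures\<close>

text \<open>Here \<open>v\<close> stands for the excess of a convex function over its minimum,
  \<theta> for the fraction of the way moved towards the minimiser, and the term with 1/8 for the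
  quadratic cost of that move.\<close>

lemma exp_le_two_minus_exp_minus:
  fixes v :: real
  assumes "0 \<le> v"
  shows "\<exists>\<theta>\<in>{0..1}. exp ((1 - \<theta>) * v + \<theta>\<^sup>2 / 8) \<le> 2 - exp (- v)"
proof (cases "1 / 2 \<le> v")
  \<comment> \<open>A large excess is removed entirely by \<theta> = 1.\<close>
  case True
  have "exp (1 / 8 :: real) \<le> 1 + 1/8 + (1/8)\<^sup>2" by (rule exp_bound) auto
  moreover have "exp (- v) \<le> 2 / 3"
  proof -
    have "3 / 2 \<le> exp v" using exp_ge_add_one_self[of v] True by linarith
    then have "inverse (exp v) \<le> inverse (3 / 2)" by (intro le_imp_inverse_le) auto
    then show ?thesis by (simp add: exp_minus)
  qed
  ultimately have "exp ((1 - 1) * v + 1\<^sup>2 / 8) \<le> 2 - exp (- v)"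
    by (simp add: power2_eq_square)
  then show ?thesis by (intro bexI[of _ 1]) auto
next
  case False
  \<comment> \<open>This is the exponent for \<theta> = 2v, which lies in the unit interval because
    v < 1/2. Both sides are then compared with 1 + v - v^2/2.\<close>
  define y where "y = v - 3 / 2 * v\<^sup>2"
  have yv: "y = v * (1 - 3 / 2 * v)" by (simp add: y_def power2_eq_square algebra_simps)
  have y: "0 \<le> y" "y \<le> v"
    using assms False by (auto simp: yv) (simp add: mult_left_le)
  have "exp y \<le> 1 + y + y\<^sup>2" using y False by (intro exp_bound) auto
  also have "y\<^sup>2 \<le> v\<^sup>2" using y by (intro power_mono) auto
  finally have 1: "exp y \<le> 1 + v - v\<^sup>2 / 2" by (simp add: y_def)
  have 2: "exp (- v) \<le> 1 - v + v\<^sup>2 / 2"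
  proof -
    have pos: "0 < 1 - v + v\<^sup>2 / 2" using False zero_le_power2[of v] by linarith
    have "1 \<le> (1 - v + v\<^sup>2 / 2) * (1 + v + v\<^sup>2 / 2)"
    proof -
      have "0 \<le> v\<^sup>2 * v\<^sup>2 / 4" by simp
      also have "\<dots> = (1 - v + v\<^sup>2 / 2) * (1 + v + v\<^sup>2 / 2) - 1"
        by (simp add: power2_eq_square algebra_simps)
      finally show ?thesis by simp
    qed
    also have "\<dots> \<le> (1 - v + v\<^sup>2 / 2) * exp v"
      using exp_lower_Taylor_quadratic[OF assms] pos by (intro mult_left_mono) auto
    finally show ?thesis by (simp add: exp_minus field_simps)
  qed
  have "(1 - 2 * v) * v + (2 * v)\<^sup>2 / 8 = y"
    by (simp add: y_def power2_eq_square algebra_simps)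
  then have "exp ((1 - 2 * v) * v + (2 * v)\<^sup>2 / 8) \<le> 2 - exp (- v)" using 1 2 by simp
  then show ?thesis using assms False by (intro bexI[of _ "2 * v"]) auto
qed

text \<open>Let \<open>r\<close> minimise \<phi> on the interval and let
  \<open>w = exp (- (\<phi> - \<phi> r))\<close>. Then \<open>G\<close> is at most
  \<open>exp (\<phi> r) * (2 - w)\<close> and \<open>H\<close> at most
  \<open>exp (- \<phi> r) * w\<close>, so the product of the integrals is at most
  \<open>(2 - z) * z\<close> with \<open>z\<close> the mean of \<open>w\<close>. As \<open>G\<close>
  and \<open>H\<close> enter through pointwise bounds, they may be integrals over other
  coordinates.\<close>

lemma transport_one_dim:
  fixes \<nu> :: "real measure" and \<phi> :: "real \<Rightarrow> real"
  assumes "prob_space \<nu>" and [measurable_cong]: "sets \<nu> = sets borel"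
    and box: "AE x in \<nu>. x \<in> {a..b}"
    and c: "0 < c" "c * (b - a)\<^sup>2 \<le> 1 / 8"
    and cvx: "\<And>x y u. u \<in> {0..1} \<Longrightarrow> \<phi> ((1 - u) * x + u * y) \<le> (1 - u) * \<phi> x + u * \<phi> y"
    and cont: "continuous_on UNIV \<phi>"
    and G: "\<And>s r. G s \<le> ennreal (exp (\<phi> r + c * (s - r)\<^sup>2))"
    and H: "\<And>s. H s \<le> ennreal (exp (- \<phi> s))"
  shows "(\<integral>\<^sup>+ s. G s \<partial>\<nu>) * (\<integral>\<^sup>+ s. H s \<partial>\<nu>) \<le> 1"
proof -
  interpret prob_space \<nu> by fact
  have [measurable]: "\<phi> \<in> borel_measurable borel"
    by (rule borel_measurable_continuous_onI[OF cont])
  have "{a..b} \<noteq> {}"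
  proof
    assume "{a..b} = {}"
    then have "AE x in \<nu>. False" using box by (simp only: empty_iff)
    then show False by simp
  qed
  from continuous_attains_inf[OF compact_Icc this continuous_on_subset[OF cont subset_UNIV]]
  obtain r where r: "r \<in> {a..b}" "\<And>x. x \<in> {a..b} \<Longrightarrow> \<phi> r \<le> \<phi> x" by blast
  define w where "w s = exp (- (\<phi> s - \<phi> r))" for s
  have [measurable]: "w \<in> borel_measurable borel" unfolding w_def by measurable
  have w: "0 \<le> w s" "s \<in> {a..b} \<Longrightarrow> w s \<le> 1" for s
    using r(2)[of s] by (auto simp: w_def)
  have w1: "AE s in \<nu>. w s \<le> 1" using box by eventually_elim (use w in auto)
  have int: "integrable \<nu> w"
    using w1 by (intro integrable_const_bound[of _ 1]) (auto simp: w_def)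
  define z where "z = expectation w"
  have z0: "0 \<le> z" unfolding z_def by (intro integral_nonneg_AE) (simp add: w)
  have z1: "z \<le> 1" unfolding z_def using integral_le_const[OF int w1] .
  have "G s \<le> ennreal (exp (\<phi> r) * (2 - w s))" if s: "s \<in> {a..b}" for s
  proof -
    obtain \<theta> where \<theta>: "\<theta> \<in> {0..1}"
      "exp ((1 - \<theta>) * (\<phi> s - \<phi> r) + \<theta>\<^sup>2 / 8) \<le> 2 - exp (- (\<phi> s - \<phi> r))"
      using exp_le_two_minus_exp_minus[of "\<phi> s - \<phi> r"] r(2)[OF s] by auto
    \<comment> \<open>The competitor lies on the segment from \<open>s\<close> to the minimiser
      \<open>r\<close>, where convexity bounds \<phi>.\<close>
    let ?q = "(1 - \<theta>) * s + \<theta> * r"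
    have "(s - r)\<^sup>2 \<le> (b - a)\<^sup>2"
      using s r(1) by (intro abs_le_square_iff[THEN iffD1]) auto
    then have "c * (s - r)\<^sup>2 \<le> 1 / 8" using c mult_left_mono[of "(s - r)\<^sup>2" "(b - a)\<^sup>2" c] by linarith
    then have "\<theta>\<^sup>2 * (c * (s - r)\<^sup>2) \<le> \<theta>\<^sup>2 * (1 / 8)" by (intro mult_left_mono) auto
    moreover have "c * (s - ?q)\<^sup>2 = \<theta>\<^sup>2 * (c * (s - r)\<^sup>2)"
      by (simp add: power2_eq_square algebra_simps)
    moreover have "\<phi> r + (1 - \<theta>) * (\<phi> s - \<phi> r) = (1 - \<theta>) * \<phi> s + \<theta> * \<phi> r"
      by (simp add: algebra_simps)
    ultimately have "\<phi> ?q + c * (s - ?q)\<^sup>2 \<le> \<phi> r + ((1 - \<theta>) * (\<phi> s - \<phi> r) + \<theta>\<^sup>2 / 8)"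
      using cvx[OF \<theta>(1), of s r] by linarith
    then have "exp (\<phi> ?q + c * (s - ?q)\<^sup>2)
        \<le> exp (\<phi> r) * exp ((1 - \<theta>) * (\<phi> s - \<phi> r) + \<theta>\<^sup>2 / 8)"
      by (simp flip: exp_add)
    also have "\<dots> \<le> exp (\<phi> r) * (2 - w s)"
      using \<theta>(2) unfolding w_def by (intro mult_left_mono) auto
    finally have "exp (\<phi> ?q + c * (s - ?q)\<^sup>2) \<le> exp (\<phi> r) * (2 - w s)" .
    then show ?thesis using G[of s ?q] by (meson ennreal_leI order_trans)
  qed
  then have "AE s in \<nu>. G s \<le> ennreal (exp (\<phi> r) * (2 - w s))"
    by (rule eventually_mono[OF box])
  then have "(\<integral>\<^sup>+ s. G s \<partial>\<nu>) \<le> (\<integral>\<^sup>+ s. ennreal (exp (\<phi> r) * (2 - w s)) \<partial>\<nu>)"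
    by (rule nn_integral_mono_AE)
  also have "\<dots> = ennreal (\<integral>s. exp (\<phi> r) * (2 - w s) \<partial>\<nu>)"
    using w1 int by (intro nn_integral_eq_integral) (auto elim!: eventually_mono)
  also have "(\<integral>s. exp (\<phi> r) * (2 - w s) \<partial>\<nu>) = exp (\<phi> r) * (2 - z)"
    using int by (simp add: z_def prob_space)
  finally have 1: "(\<integral>\<^sup>+ s. G s \<partial>\<nu>) \<le> ennreal (exp (\<phi> r) * (2 - z))" .
  have "(\<integral>\<^sup>+ s. H s \<partial>\<nu>) \<le> (\<integral>\<^sup>+ s. ennreal (exp (- \<phi> r) * w s) \<partial>\<nu>)"
    using H by (intro nn_integral_mono) (auto simp: w_def simp flip: exp_add)
  also have "\<dots> = ennreal (\<integral>s. exp (- \<phi> r) * w s \<partial>\<nu>)"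
    using int w by (intro nn_integral_eq_integral) auto
  finally have 2: "(\<integral>\<^sup>+ s. H s \<partial>\<nu>) \<le> ennreal (exp (- \<phi> r) * z)"
    by (simp add: z_def)
  have "(\<integral>\<^sup>+ s. G s \<partial>\<nu>) * (\<integral>\<^sup>+ s. H s \<partial>\<nu>)
      \<le> ennreal (exp (\<phi> r) * (2 - z)) * ennreal (exp (- \<phi> r) * z)"
    by (rule mult_mono[OF 1 2]) auto
  also have "\<dots> = ennreal ((exp (\<phi> r) * exp (- \<phi> r)) * ((2 - z) * z))"
    using z0 z1 by (simp only: ennreal_mult[symmetric] mult_nonneg_nonneg exp_ge_zero) (simp add: ac_simps)
  also have "\<dots> = ennreal ((2 - z) * z)" by (simp flip: exp_add)
  \<comment> \<open>\<open>(2 - z) * z = 1 - (z - 1)^2\<close>.\<close>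
  also have "\<dots> \<le> 1"
    using zero_le_power2[of "z - 1"] by (simp add: ennreal_le_1 power2_eq_square algebra_simps)
  finally show ?thesis .
qed

section \<open>Tensorisation over the coordinates\<close>

text \<open>A form of Hoelder's inequality. Once \<open>A\<close> and \<open>B\<close> are shifted
  so that their exponentials have mean 1, convexity of \<open>exp\<close> gives a pointwise bound
  whose right-hand side integrates to 1.\<close>

lemma (in prob_space) ln_expectation_exp_mix:
  assumes int: "integrable M (\<lambda>x. exp (A x :: real))" "integrable M (\<lambda>x. exp (B x :: real))"
      "integrable M (\<lambda>x. exp (C x :: real))"
    and u: "u \<in> {0..1}" and C: "\<And>x. C x \<le> (1 - u) * A x + u * B x"
  shows "ln (expectation (\<lambda>x. exp (C x)))
     \<le> (1 - u) * ln (expectation (\<lambda>x. exp (A x))) + u * ln (expectation (\<lambda>x. exp (B x)))"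
proof -
  have pos: "0 < expectation (\<lambda>x. exp (A x))" "0 < expectation (\<lambda>x. exp (B x))"
    "0 < expectation (\<lambda>x. exp (C x))"
    using int by (auto intro!: expectation_greater)
  define p q where "p = ln (expectation (\<lambda>x. exp (A x)))" "q = ln (expectation (\<lambda>x. exp (B x)))"
  let ?m = "(1 - u) * p + u * q"
  have *: "exp (C x - ?m) \<le> (1 - u) * exp (A x - p) + u * exp (B x - q)" for x
  proof -
    have "exp (C x - ?m) \<le> exp ((1 - u) * (A x - p) + u * (B x - q))"
      using C[of x] by (simp add: algebra_simps)
    also have "\<dots> \<le> (1 - u) * exp (A x - p) + u * exp (B x - q)"
      using u convex_onD[OF exp_convex, of u "A x - p" "B x - q"] by simp
    finally show ?thesis .
  qed
  have "expectation (\<lambda>x. exp (C x - ?m))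
      \<le> expectation (\<lambda>x. (1 - u) * exp (A x - p) + u * exp (B x - q))"
    using int * by (intro integral_mono) (auto simp: exp_diff)
  also have "\<dots> = 1"
    using int pos by (simp add: exp_diff p_q_def)
  finally have "expectation (\<lambda>x. exp (C x)) \<le> exp ?m"
    by (simp add: exp_diff)
  then have "ln (expectation (\<lambda>x. exp (C x))) \<le> ?m"
    using ln_le_cancel_iff[OF pos(3) exp_gt_zero[of ?m]] by simp
  then show ?thesis by (simp add: p_q_def)
qed

text \<open>The family is indexed by all of \<open>nat\<close>, so that the induction on the
  dimension can split off one more factor. The condition on \<open>c\<close> bounds the cost of a
  move inside the interval by 1/8.\<close>

locale box_measures =
  fixes \<mu> :: "nat \<Rightarrow> real measure" and a b c :: real
  assumes prob_space_\<mu>: "\<And>i. prob_space (\<mu> i)"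
    and sets_\<mu> [measurable_cong]: "\<And>i. sets (\<mu> i) = sets borel"
    and AE_box: "\<And>i. AE x in \<mu> i. x \<in> {a..b}"
    and c_pos: "0 < c" and c_le: "c * (b - a)\<^sup>2 \<le> 1 / 8"
begin

sublocale product_sigma_finite \<mu>
  by unfold_locales (metis prob_space_\<mu> prob_space_imp_sigma_finite sigma_finite_measure.sigma_finite_countable)

abbreviation "P n \<equiv> PiM {..<n} \<mu>"

lemma prob_space_P: "prob_space (P n)"
  by (intro prob_space_PiM prob_space_\<mu>)

lemma borel_measurable_P:
  assumes "\<And>x y. \<bar>f x - f y\<bar> \<le> L * L2_set (\<lambda>i. x i - y i) {..<n}"
  shows "f \<in> borel_measurable (P n)"
proof -
  have "sets (P n) = sets (PiM {..<n} (\<lambda>_. borel))" by (intro sets_PiM_cong sets_\<mu> refl)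
  then show ?thesis using measurable_lipschitz[OF assms] measurable_cong_sets by blast
qed

lemma lipschitz_AE_bounded:
  assumes "0 \<le> L" and lip: "\<And>x y. \<bar>f x - f y\<bar> \<le> L * L2_set (\<lambda>i. x i - y i) {..<n}"
  shows "\<exists>B. AE x in P n. \<bar>f x\<bar> \<le> B"
proof -
  have "AE x in P n. \<forall>i\<in>{..<n}. x i \<in> {a..b}"
    by (intro eventually_ball_finite ballI AE_PiM_component prob_space_\<mu> AE_box) auto
  then have "AE x in P n. \<bar>f x\<bar> \<le> \<bar>f (\<lambda>_. a)\<bar> + L * (\<Sum>i<n. b - a)"
  proof eventually_elim
    case (elim x)
    have "L2_set (\<lambda>i. x i - a) {..<n} \<le> (\<Sum>i<n. \<bar>x i - a\<bar>)" by (rule L2_set_le_sum_abs)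
    also have "\<dots> \<le> (\<Sum>i<n. b - a)" using elim by (intro sum_mono) auto
    finally have "L * L2_set (\<lambda>i. x i - a) {..<n} \<le> L * (\<Sum>i<n. b - a)"
      using assms(1) by (intro mult_left_mono)
    then show ?case using lip[of x "\<lambda>_. a"] by linarith
  qed
  then show ?thesis by blast
qed

lemma integrable_lipschitz:
  assumes "0 \<le> L" and lip: "\<And>x y. \<bar>f x - f y\<bar> \<le> L * L2_set (\<lambda>i. x i - y i) {..<n}"
  shows "integrable (P n) f" and "integrable (P n) (\<lambda>x. exp (f x))"
proof -
  interpret prob_space "P n" by (rule prob_space_P)
  note [measurable] = borel_measurable_P[OF lip]
  obtain B where B: "AE x in P n. \<bar>f x\<bar> \<le> B" using lipschitz_AE_bounded[OF assms] by blast
  show "integrable (P n) f"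
    using B by (intro integrable_const_bound[of _ B]) auto
  show "integrable (P n) (\<lambda>x. exp (f x))"
    by (intro integrable_const_bound[of _ "exp B"] eventually_mono[OF B]) auto
qed

lemma inf_conv_section_convex_continuous:
  assumes L: "0 \<le> L" and f: "convex_lipschitz (Suc n) L f"
  defines "\<phi> \<equiv> \<lambda>r. ln (\<integral>x. exp (inf_conv n c (\<lambda>x. f (x(n := r))) x) \<partial>P n)"
  shows "u \<in> {0..1} \<Longrightarrow> \<phi> ((1 - u) * r + u * s) \<le> (1 - u) * \<phi> r + u * \<phi> s"
    and "continuous_on UNIV \<phi>"
    and "(\<integral>\<^sup>+ x. ennreal (exp (inf_conv n c (\<lambda>x. f (x(n := r))) x)) \<partial>P n) = ennreal (exp (\<phi> r))"
proof -
  interpret prob_space "P n" by (rule prob_space_P)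
  define g where "g = (\<lambda>r x. f (x(n := r)))"
  define A where "A r x = inf_conv n c (g r) x" for r x
  have g: "convex_lipschitz n L (g r)" for r
    unfolding g_def by (rule convex_lipschitz_section[OF f])
  have int: "integrable (P n) (\<lambda>x. exp (A r x))" for r
    unfolding A_def
    by (rule integrable_lipschitz(2)[OF L convex_lipschitzD(2)[OF convex_lipschitz_inf_conv[OF c_pos g]]])
  have pos: "0 < expectation (\<lambda>x. exp (A r x))" for r
    using int by (auto intro!: expectation_greater)
  have \<phi>: "\<phi> r = ln (expectation (\<lambda>x. exp (A r x)))" for r
    by (simp add: \<phi>_def A_def g_def)
  show "(\<integral>\<^sup>+ x. ennreal (exp (inf_conv n c (\<lambda>x. f (x(n := r))) x)) \<partial>P n) = ennreal (exp (\<phi> r))"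
    using nn_integral_eq_integral[OF int, of r] pos[of r]
    unfolding \<phi> by (simp add: A_def g_def)
  show "\<phi> ((1 - u) * r + u * s) \<le> (1 - u) * \<phi> r + u * \<phi> s" if u: "u \<in> {0..1}"
  proof -
    let ?t = "(1 - u) * r + u * s"
    have "A ?t x \<le> (1 - u) * A r x + u * A s x" for x
    proof -
      have "g ?t (\<lambda>i. (1 - u) * y i + u * z i) \<le> (1 - u) * g r y + u * g s z" for y z
      proof -
        have "(\<lambda>i. (1 - u) * y i + u * z i)(n := ?t) =
            (\<lambda>i. (1 - u) * (y(n := r)) i + u * (z(n := s)) i)"
          by (auto simp: fun_eq_iff)
        then show ?thesis
          unfolding g_def using convex_lipschitzD(1)[OF f u, of "y(n := r)" "z(n := s)"] by simp
      qed
      from inf_conv_mix[OF c_pos g g g u this, of x x]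
      show ?thesis by (simp add: A_def algebra_simps)
    qed
    then show ?thesis
      unfolding \<phi> by (intro ln_expectation_exp_mix int u)
  qed
  have le: "\<phi> r \<le> \<phi> s + L * \<bar>r - s\<bar>" for r s
  proof -
    have "A r x \<le> A s x + L * \<bar>r - s\<bar>" for x
      unfolding A_def
    proof (rule inf_conv_mono[OF c_pos g])
      fix y
      have "L2_set (\<lambda>i. (y(n := r)) i - (y(n := s)) i) {..<Suc n} = \<bar>r - s\<bar>"
        by (simp add: L2_set_def)
      then show "g r y \<le> g s y + L * \<bar>r - s\<bar>"
        using convex_lipschitzD(2)[OF f, of "y(n := r)" "y(n := s)"] by (simp add: g_def)
    qed
    then have "expectation (\<lambda>x. exp (A r x))
        \<le> expectation (\<lambda>x. exp (A s x) * exp (L * \<bar>r - s\<bar>))"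
      by (intro integral_mono int integrable_mult_left) (simp flip: exp_add)
    then have "expectation (\<lambda>x. exp (A r x)) \<le> expectation (\<lambda>x. exp (A s x)) * exp (L * \<bar>r - s\<bar>)"
      by simp
    then have "\<phi> r \<le> ln (expectation (\<lambda>x. exp (A s x)) * exp (L * \<bar>r - s\<bar>))"
      unfolding \<phi> using pos by (subst ln_le_cancel_iff) auto
    also have "\<dots> = \<phi> s + L * \<bar>r - s\<bar>"
      unfolding \<phi> using pos[of s] by (subst ln_mult_pos) auto
    finally show ?thesis .
  qed
  have "L-lipschitz_on UNIV \<phi>"
  proof (rule lipschitz_onI[OF _ L])
    fix r s show "dist (\<phi> r) (\<phi> s) \<le> L * dist r s"
      using le[of r s] le[of s r] by (simp add: dist_real_def abs_minus_commute abs_le_iff)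
  qed
  then show "continuous_on UNIV \<phi>" by (rule lipschitz_on_continuous_on)
qed

text \<open>Maurey's argument: the property passes from \<open>\<mu> 0, \<dots>, \<mu> (n - 1)\<close> to \<open>\<mu> 0, \<dots>, \<mu> n\<close> by
  applying the one-dimensional case to \<open>\<phi> r = ln (\<integral> exp (Q (f(\<cdot>, r))))\<close>, which is again convex
  because the infimal convolution \<open>Q (f(\<cdot>, r))\<close> is jointly convex.\<close>

theorem inf_conv_property:
  assumes L: "0 \<le> L" and f: "convex_lipschitz n L f"
  shows "(\<integral>\<^sup>+ x. ennreal (exp (inf_conv n c f x)) \<partial>P n) *
         (\<integral>\<^sup>+ x. ennreal (exp (- f x)) \<partial>P n) \<le> 1"
  using f
proof (induction n arbitrary: f)
  case 0
  \<comment> \<open>The empty product is the point mass at this function; taking the point itself as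
    competitor costs nothing.\<close>
  let ?x = "\<lambda>_. undefined :: real"
  have "inf_conv 0 c f ?x \<le> f ?x" using inf_conv_le[OF c_pos 0, of ?x ?x] by simp
  then show ?case
    by (simp add: nn_integral_empty ennreal_le_1 flip: ennreal_mult exp_add)
next
  case (Suc n)
  note f = Suc.prems
  define \<phi> where "\<phi> r = ln (\<integral>x. exp (inf_conv n c (\<lambda>x. f (x(n := r))) x) \<partial>P n)" for r
  note \<phi> = inf_conv_section_convex_continuous[OF L f, folded \<phi>_def]
  have ins: "{..<Suc n} = insert n {..<n}" by auto
  have Qm: "inf_conv (Suc n) c f \<in> borel_measurable (PiM (insert n {..<n}) \<mu>)"
    using borel_measurable_P[OF convex_lipschitzD(2)[OF convex_lipschitz_inf_conv[OF c_pos f]]]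
    by (simp add: ins)
  have fm: "f \<in> borel_measurable (PiM (insert n {..<n}) \<mu>)"
    using borel_measurable_P[OF convex_lipschitzD(2)[OF f]] by (simp add: ins)
  note [measurable] = Qm fm
  define G where "G s = (\<integral>\<^sup>+ x. ennreal (exp (inf_conv (Suc n) c f (x(n := s)))) \<partial>P n)" for s
  define H where "H s = (\<integral>\<^sup>+ x. ennreal (exp (- f (x(n := s)))) \<partial>P n)" for s
  have 1: "(\<integral>\<^sup>+ x. ennreal (exp (inf_conv (Suc n) c f x)) \<partial>P (Suc n)) = (\<integral>\<^sup>+ s. G s \<partial>\<mu> n)"
    unfolding G_def ins by (rule product_nn_integral_insert_rev) auto
  have 2: "(\<integral>\<^sup>+ x. ennreal (exp (- f x)) \<partial>P (Suc n)) = (\<integral>\<^sup>+ s. H s \<partial>\<mu> n)"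
    unfolding H_def ins by (rule product_nn_integral_insert_rev) auto
  have "G s \<le> ennreal (exp (\<phi> r + c * (s - r)\<^sup>2))" for s r
  proof -
    have m: "inf_conv n c (\<lambda>x. f (x(n := r))) \<in> borel_measurable (P n)"
      by (rule borel_measurable_P[OF convex_lipschitzD(2)[OF
            convex_lipschitz_inf_conv[OF c_pos convex_lipschitz_section[OF f]]]])
    have "G s \<le> (\<integral>\<^sup>+ x. ennreal (exp (inf_conv n c (\<lambda>x. f (x(n := r))) x)) *
        ennreal (exp (c * (s - r)\<^sup>2)) \<partial>P n)"
      unfolding G_def
    proof (rule nn_integral_mono)
      fix x
      show "ennreal (exp (inf_conv (Suc n) c f (x(n := s)))) \<le>
          ennreal (exp (inf_conv n c (\<lambda>x. f (x(n := r))) x)) * ennreal (exp (c * (s - r)\<^sup>2))"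
        using inf_conv_section[OF c_pos f, of x s r]
        by (simp only: ennreal_mult[OF exp_ge_zero exp_ge_zero, symmetric] exp_add[symmetric]
            ennreal_le_iff exp_ge_zero exp_le_cancel_iff)
    qed
    also have "\<dots> = ennreal (exp (\<phi> r)) * ennreal (exp (c * (s - r)\<^sup>2))"
      using m by (subst nn_integral_multc) (auto simp: \<phi>(3))
    also have "\<dots> = ennreal (exp (\<phi> r + c * (s - r)\<^sup>2))"
      by (simp add: exp_add flip: ennreal_mult)
    finally show ?thesis .
  qed
  moreover have "H s \<le> ennreal (exp (- \<phi> s))" for s
  proof -
    \<comment> \<open>The first factor of the induction hypothesis for the section at
      \<open>s\<close> is \<open>exp (\<phi> s)\<close>; cancelling it bounds
      \<open>H s\<close>.\<close>
    have "ennreal (exp (\<phi> s)) * H s \<le> 1"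
      using Suc.IH[OF convex_lipschitz_section[OF f, of s]] unfolding \<phi>(3) H_def .
    then have "ennreal (exp (- \<phi> s)) * (ennreal (exp (\<phi> s)) * H s) \<le> ennreal (exp (- \<phi> s)) * 1"
      by (rule mult_left_mono) simp
    then show ?thesis by (simp add: mult.assoc[symmetric] flip: ennreal_mult exp_add)
  qed
  ultimately show ?case
    unfolding 1 2
    by (intro transport_one_dim[of "\<mu> n" a b c \<phi>] prob_space_\<mu> sets_\<mu> AE_box c_pos c_le \<phi>(1,2))
qed

section \<open>Exponential moments of centred functions\<close>

lemma exp_moment_centered:
  assumes f: "convex_lipschitz n 1 f" and l: "0 \<le> l"
  defines "m \<equiv> (\<integral>x. f x \<partial>P n)"
  shows "(\<integral>\<^sup>+ x. ennreal (exp (l * (f x - m))) \<partial>P n) \<le> ennreal (exp (l\<^sup>2 / (4 * c)))"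
    and "(\<integral>\<^sup>+ x. ennreal (exp (- (l * (f x - m)))) \<partial>P n) \<le> ennreal (exp (l\<^sup>2 / (4 * c)))"
proof -
  interpret prob_space "P n" by (rule prob_space_P)
  note [measurable] = borel_measurable_P[OF convex_lipschitzD(2)[OF f]]
  have int: "integrable (P n) f" by (rule integrable_lipschitz(1)[OF _ convex_lipschitzD(2)[OF f]]) simp
  define h where "h x = l * (f x - m)" for x
  have h: "convex_lipschitz n l h"
    unfolding convex_lipschitz_def
  proof (intro conjI allI ballI)
    fix x y u assume u: "u \<in> {0..1::real}"
    have "h (\<lambda>i. (1 - u) * x i + u * y i) \<le> l * ((1 - u) * f x + u * f y - m)"
      unfolding h_def using l convex_lipschitzD(1)[OF f u] by (intro mult_left_mono) auto
    then show "h (\<lambda>i. (1 - u) * x i + u * y i) \<le> (1 - u) * h x + u * h y"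
      by (simp add: h_def algebra_simps)
  next
    fix x y
    have "\<bar>h x - h y\<bar> = l * \<bar>f x - f y\<bar>"
      using l by (simp add: h_def abs_mult flip: right_diff_distrib)
    also have "\<dots> \<le> l * L2_set (\<lambda>i. x i - y i) {..<n}"
      using convex_lipschitzD(2)[OF f, of x y] l by (intro mult_left_mono) auto
    finally show "\<bar>h x - h y\<bar> \<le> l * L2_set (\<lambda>i. x i - y i) {..<n}" .
  qed
  have hint: "integrable (P n) h" "expectation h = 0"
    using int unfolding h_def by (auto simp: m_def prob_space)
  \<comment> \<open>Jensen's inequality in the form \<open>1 + k \<le> exp k\<close>; an infinite
    integral satisfies the bound trivially.\<close>
  have ge: "1 \<le> (\<integral>\<^sup>+ x. ennreal (exp (k x)) \<partial>P n)"
    if k: "integrable (P n) k" "expectation k = 0" for k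
  proof -
    note [measurable] = borel_measurable_integrable[OF k(1)]
    have le: "(\<integral>\<^sup>+ x. ennreal (1 + k x) \<partial>P n) \<le> (\<integral>\<^sup>+ x. ennreal (exp (k x)) \<partial>P n)"
      by (intro nn_integral_mono ennreal_leI exp_ge_add_one_self)
    show ?thesis
    proof (cases "\<integral>\<^sup>+ x. ennreal (exp (k x)) \<partial>P n")
      case (real r)
      then have "expectation (\<lambda>x. 1 + k x) \<le> r" using le by (intro integral_real_bounded) auto
      then show ?thesis using k real by (simp add: prob_space)
    qed simp
  qed
  define E where "E = ennreal (exp (- (l\<^sup>2 / (4 * c))))"
  have "E * (\<integral>\<^sup>+ x. ennreal (exp (h x)) \<partial>P n) = (\<integral>\<^sup>+ x. ennreal (exp (h x - l\<^sup>2 / (4 * c))) \<partial>P n)"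
    unfolding E_def h_def
    by (subst nn_integral_cmult[symmetric]) (auto simp flip: ennreal_mult exp_add intro!: nn_integral_cong)
  also have "\<dots> \<le> (\<integral>\<^sup>+ x. ennreal (exp (inf_conv n c h x)) \<partial>P n)"
    using inf_conv_ge[OF c_pos h] by (intro nn_integral_mono) auto
  finally have le: "E * (\<integral>\<^sup>+ x. ennreal (exp (h x)) \<partial>P n) * (\<integral>\<^sup>+ x. ennreal (exp (- h x)) \<partial>P n) \<le> 1"
    using inf_conv_property[OF l h] by (meson mult_right_mono order_trans zero_le)
  have E: "z \<le> ennreal (exp (l\<^sup>2 / (4 * c)))" if "E * z \<le> 1" for z
  proof -
    have "ennreal (exp (l\<^sup>2 / (4 * c))) * (E * z) \<le> ennreal (exp (l\<^sup>2 / (4 * c))) * 1"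
      using that by (rule mult_left_mono) simp
    then show ?thesis by (simp add: E_def mult.assoc[symmetric] flip: ennreal_mult exp_add)
  qed
  \<comment> \<open>The factor with \<open>- h\<close> is at least 1 and is dropped; below, the
    factor with \<open>h\<close> is dropped in the same way.\<close>
  have "E * (\<integral>\<^sup>+ x. ennreal (exp (h x)) \<partial>P n) * 1 \<le> 1"
    using ge[of "\<lambda>x. - h x"] hint le by (intro order_trans[OF mult_left_mono le]) auto
  then show "(\<integral>\<^sup>+ x. ennreal (exp (l * (f x - m))) \<partial>P n) \<le> ennreal (exp (l\<^sup>2 / (4 * c)))"
    using E by (simp add: h_def)
  have "E * 1 * (\<integral>\<^sup>+ x. ennreal (exp (- h x)) \<partial>P n) \<le> 1"
    using ge[of h] hint by (intro order_trans[OF mult_right_mono[OF mult_left_mono] le]) auto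
  then show "(\<integral>\<^sup>+ x. ennreal (exp (- (l * (f x - m)))) \<partial>P n) \<le> ennreal (exp (l\<^sup>2 / (4 * c)))"
    using E by (simp add: h_def)
qed

end

section \<open>Concentration for bounded variables\<close>

text \<open>The sum over \<open>k\<close> of the geometric series
  \<open>2 * exp (1 / 8) * exp (- (1 / 16)) ^ k\<close>.\<close>

definition gauss_const :: real where
  "gauss_const = 2 * exp (1 / 8) * (1 / (1 - exp (- (1 / 16))))"

text \<open>The Gaussian moment is bounded by exponential ones through tangents to the parabola:
  \<open>z\<^sup>2 \<le> 2 * k * z - k\<^sup>2 + 1\<close> for the integer part \<open>k\<close> of \<open>z\<close>.\<close>

lemma (in prob_space) exp_square_moment:
  fixes Z :: "'a \<Rightarrow> real"
  assumes Z [measurable]: "Z \<in> borel_measurable M" and s: "0 < s"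
    and l: "\<And>l. 0 \<le> l \<Longrightarrow> (\<integral>\<^sup>+ \<omega>. ennreal (exp (l * \<bar>Z \<omega>\<bar>)) \<partial>M) \<le> ennreal (2 * exp (l\<^sup>2 * s\<^sup>2))"
  shows "(\<integral>\<^sup>+ \<omega>. ennreal (exp ((Z \<omega> / s)\<^sup>2 / 8)) \<partial>M) \<le> ennreal gauss_const"
proof -
  \<comment> \<open>One eighth of the tangent at the integer \<open>k\<close>, exponentiated: the
    term linear in \<bar>Z\<bar> has coefficient \<open>k / (4 * s)\<close>, which is the parameter
    \<open>l\<close> at which the hypothesis is used.\<close>
  define T where "T k \<omega> = ennreal (exp ((1 - (real k)\<^sup>2) / 8)) *
    ennreal (exp (real k / (4 * s) * \<bar>Z \<omega>\<bar>))" for k :: nat and \<omega>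
  have le: "ennreal (exp ((Z \<omega> / s)\<^sup>2 / 8)) \<le> (\<Sum>k. T k \<omega>)" for \<omega>
  proof -
    define z where "z = \<bar>Z \<omega>\<bar> / s"
    define k where "k = nat \<lfloor>z\<rfloor>"
    have z0: "0 \<le> z" using s by (simp add: z_def)
    then have k: "real k \<le> z" "z < real k + 1" unfolding k_def by linarith+
    then have "(z - real k)\<^sup>2 \<le> 1" by (intro power_le_one) auto
    then have "z\<^sup>2 \<le> 1 - (real k)\<^sup>2 + 2 * real k * z" by (simp add: power2_eq_square algebra_simps)
    then have "z\<^sup>2 / 8 \<le> (1 - (real k)\<^sup>2) / 8 + real k / (4 * s) * \<bar>Z \<omega>\<bar>"
      by (simp add: z_def field_simps)
    moreover have "(Z \<omega> / s)\<^sup>2 = z\<^sup>2" by (simp add: z_def power_divide)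
    ultimately have "ennreal (exp ((Z \<omega> / s)\<^sup>2 / 8)) \<le> T k \<omega>"
      unfolding T_def by (simp flip: ennreal_mult exp_add)
    also have "\<dots> \<le> (\<Sum>k. T k \<omega>)"
      using sum_le_suminf[OF summableI, of "{k}" "\<lambda>k. T k \<omega>"] by simp
    finally show ?thesis .
  qed
  have T: "(\<integral>\<^sup>+ \<omega>. T k \<omega> \<partial>M) \<le> ennreal (2 * exp (1 / 8) * exp (- (1 / 16)) ^ k)" for k
  proof -
    have "(\<integral>\<^sup>+ \<omega>. T k \<omega> \<partial>M) = ennreal (exp ((1 - (real k)\<^sup>2) / 8)) *
        (\<integral>\<^sup>+ \<omega>. ennreal (exp (real k / (4 * s) * \<bar>Z \<omega>\<bar>)) \<partial>M)"
      unfolding T_def by (rule nn_integral_cmult) measurable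
    also have "\<dots> \<le> ennreal (exp ((1 - (real k)\<^sup>2) / 8)) *
        ennreal (2 * exp ((real k / (4 * s))\<^sup>2 * s\<^sup>2))"
      using s by (intro mult_left_mono l) auto
    also have "\<dots> = ennreal (2 * exp ((1 - (real k)\<^sup>2) / 8 + (real k / (4 * s))\<^sup>2 * s\<^sup>2))"
      by (simp add: exp_add mult.left_commute flip: ennreal_mult)
    also have "(1 - (real k)\<^sup>2) / 8 + (real k / (4 * s))\<^sup>2 * s\<^sup>2 = 1 / 8 - (real k)\<^sup>2 / 16"
      using s by (simp add: power2_eq_square field_simps)
    also have "2 * exp (1 / 8 - (real k)\<^sup>2 / 16) \<le> 2 * exp (1 / 8 + real k * - (1 / 16))"
    proof -
      \<comment> \<open>Gaussian decay in \<open>k\<close> is weakened to geometric decay, so that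
        the series has a closed form.\<close>
      have "k \<le> k\<^sup>2" by (simp add: power2_eq_square)
      then have "real k \<le> (real k)\<^sup>2" by (metis of_nat_le_iff of_nat_power)
      then show ?thesis by simp
    qed
    also have "\<dots> = 2 * exp (1 / 8) * exp (- (1 / 16)) ^ k"
      unfolding exp_add exp_of_nat_mult by simp
    finally show ?thesis by (simp add: ennreal_leI)
  qed
  have "(\<integral>\<^sup>+ \<omega>. ennreal (exp ((Z \<omega> / s)\<^sup>2 / 8)) \<partial>M) \<le> (\<integral>\<^sup>+ \<omega>. (\<Sum>k. T k \<omega>) \<partial>M)"
    by (intro nn_integral_mono le)
  also have "\<dots> = (\<Sum>k. \<integral>\<^sup>+ \<omega>. T k \<omega> \<partial>M)"
    unfolding T_def by (rule nn_integral_suminf) measurable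
  also have "\<dots> \<le> (\<Sum>k. ennreal (2 * exp (1 / 8) * exp (- (1 / 16)) ^ k))"
    by (intro suminf_le T summableI)
  also have "\<dots> = ennreal gauss_const"
    unfolding gauss_const_def
    by (intro suminf_ennreal_eq sums_mult geometric_sums) auto
  finally show ?thesis .
qed

lemma (in prob_space) bounded_convex_concentration:
  assumes indep: "indep_vars (\<lambda>_. borel) Y {..<n}" and n: "1 \<le> n"
    and bnd: "\<And>i \<omega>. i < n \<Longrightarrow> \<bar>Y i \<omega>\<bar> \<le> \<beta>" and \<beta>: "0 < \<beta>"
    and F: "convex_lipschitz n 1 F"
  defines "G \<equiv> \<lambda>\<omega>. F (\<lambda>i\<in>{..<n}. Y i \<omega>)"
  shows "integrable M G"
    and "(\<integral>\<^sup>+ \<omega>. ennreal (exp (((G \<omega> - expectation G) / (3 * \<beta>))\<^sup>2 / 8)) \<partial>M) \<le> ennreal gauss_const"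
proof -
  have Y [measurable]: "Y i \<in> borel_measurable M" if "i < n" for i
    using indep that by (auto simp: indep_vars_def)
  \<comment> \<open>The locale asks for a measure at every index; beyond \<open>n\<close> a point
    mass inside the interval serves.\<close>
  define \<mu> where "\<mu> i = (if i < n then distr M borel (Y i) else return borel 0)" for i
  \<comment> \<open>The interval has length \<open>2 * \<beta>\<close>, so
    \<open>c * (2 * \<beta>)^2 = 1 / 8\<close>. The exponent \<open>l^2 / (4 * c)\<close> becomes
    \<open>8 * \<beta>^2 * l^2\<close>, and 8 is rounded up to the square of 3.\<close>
  define c where "c = 1 / (32 * \<beta>\<^sup>2)"
  interpret B: box_measures \<mu> "- \<beta>" \<beta> c
  proof (rule box_measures.intro)
    show "prob_space (\<mu> i)" for i
      by (auto simp: \<mu>_def intro!: prob_space_distr prob_space_return)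
    show "sets (\<mu> i) = sets borel" for i by (simp add: \<mu>_def)
    show "AE x in \<mu> i. x \<in> {- \<beta>..\<beta>}" for i
    proof (cases "i < n")
      case True
      have "AE \<omega> in M. Y i \<omega> \<in> {- \<beta>..\<beta>}"
        using bnd[OF True] by (intro AE_I2) (auto simp: abs_le_iff minus_le_iff)
      then have "AE x in distr M borel (Y i). x \<in> {- \<beta>..\<beta>}"
        using True by (subst AE_distr_iff) simp_all
      then show ?thesis using True unfolding \<mu>_def by simp
    next
      case False
      then show ?thesis using \<beta> unfolding \<mu>_def by (simp add: AE_return)
    qed
    show "0 < c" using \<beta> by (simp add: c_def)
    show "c * (\<beta> - - \<beta>)\<^sup>2 \<le> 1 / 8" using \<beta> by (simp add: c_def power2_eq_square field_simps)
  qed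
  let ?V = "\<lambda>\<omega>. \<lambda>i\<in>{..<n}. Y i \<omega>"
  let ?B = "PiM {..<n} (\<lambda>_. borel :: real measure)"
  have V [measurable]: "?V \<in> measurable M ?B" by (intro measurable_restrict) auto
  have D: "distr M ?B ?V = B.P n"
  proof -
    have "{..<n} \<noteq> {}" using n by (auto simp: lessThan_empty_iff)
    then have "distr M ?B ?V = PiM {..<n} (\<lambda>i. distr M borel (Y i))"
      using indep by (subst (asm) indep_vars_iff_distr_eq_PiM') auto
    also have "\<dots> = B.P n" by (intro PiM_cong) (auto simp: \<mu>_def)
    finally show ?thesis .
  qed
  have F' [measurable]: "F \<in> borel_measurable ?B"
    by (rule measurable_lipschitz[OF convex_lipschitzD(2)[OF F]])
  have G [measurable]: "G \<in> borel_measurable M" unfolding G_def by measurable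
  define m where "m = (\<integral>x. F x \<partial>B.P n)"
  have m: "expectation G = m"
    unfolding m_def D[symmetric] G_def by (rule integral_distr[symmetric]) measurable
  show "integrable M G"
    using B.integrable_lipschitz(1)[OF zero_le_one convex_lipschitzD(2)[OF F]]
    unfolding G_def D[symmetric] by (rule integrable_distr[OF V])
  let ?Z = "\<lambda>\<omega>. G \<omega> - m"
  have "(\<integral>\<^sup>+ \<omega>. ennreal (exp (l * \<bar>?Z \<omega>\<bar>)) \<partial>M) \<le> ennreal (2 * exp (l\<^sup>2 * (3 * \<beta>)\<^sup>2))"
    if l: "0 \<le> l" for l
  proof -
    have "(\<integral>\<^sup>+ \<omega>. ennreal (exp (l * \<bar>?Z \<omega>\<bar>)) \<partial>M)
        \<le> (\<integral>\<^sup>+ \<omega>. ennreal (exp (l * ?Z \<omega>)) + ennreal (exp (- (l * ?Z \<omega>))) \<partial>M)"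
    proof (intro nn_integral_mono)
      fix \<omega>
      show "ennreal (exp (l * \<bar>?Z \<omega>\<bar>)) \<le> ennreal (exp (l * ?Z \<omega>)) + ennreal (exp (- (l * ?Z \<omega>)))"
        by (cases "0 \<le> ?Z \<omega>") (auto simp: right_diff_distrib simp flip: ennreal_plus)
    qed
    also have "\<dots> = (\<integral>\<^sup>+ \<omega>. ennreal (exp (l * ?Z \<omega>)) \<partial>M) + (\<integral>\<^sup>+ \<omega>. ennreal (exp (- (l * ?Z \<omega>))) \<partial>M)"
      by (rule nn_integral_add) auto
    also have "(\<integral>\<^sup>+ \<omega>. ennreal (exp (l * ?Z \<omega>)) \<partial>M) = (\<integral>\<^sup>+ x. ennreal (exp (l * (F x - m))) \<partial>B.P n)"
      unfolding D[symmetric] G_def by (rule nn_integral_distr[symmetric]) measurable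
    also have "(\<integral>\<^sup>+ \<omega>. ennreal (exp (- (l * ?Z \<omega>))) \<partial>M) =
        (\<integral>\<^sup>+ x. ennreal (exp (- (l * (F x - m)))) \<partial>B.P n)"
      unfolding D[symmetric] G_def by (rule nn_integral_distr[symmetric]) measurable
    also have "(\<integral>\<^sup>+ x. ennreal (exp (l * (F x - m))) \<partial>B.P n) +
          (\<integral>\<^sup>+ x. ennreal (exp (- (l * (F x - m)))) \<partial>B.P n)
        \<le> ennreal (exp (l\<^sup>2 / (4 * c))) + ennreal (exp (l\<^sup>2 / (4 * c)))"
      unfolding m_def by (intro add_mono B.exp_moment_centered F l)
    also have "\<dots> = ennreal (2 * exp (l\<^sup>2 / (4 * c)))" by (simp flip: ennreal_plus)
    also have "\<dots> \<le> ennreal (2 * exp (l\<^sup>2 * (3 * \<beta>)\<^sup>2))"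
    proof -
      have "l\<^sup>2 / (4 * c) = l\<^sup>2 * (8 * \<beta>\<^sup>2)" using \<beta> by (simp add: c_def field_simps)
      also have "\<dots> \<le> l\<^sup>2 * (3 * \<beta>)\<^sup>2" by (intro mult_left_mono) (auto simp: power2_eq_square)
      finally show ?thesis by (intro ennreal_leI) simp
    qed
    finally show ?thesis .
  qed
  then show "(\<integral>\<^sup>+ \<omega>. ennreal (exp (((G \<omega> - expectation G) / (3 * \<beta>))\<^sup>2 / 8)) \<partial>M) \<le> ennreal gauss_const"
    unfolding m using \<beta> by (intro exp_square_moment) auto
qed

section \<open>Moments of the exceedances\<close>

text \<open>After division by the sum both terms lie in the unit interval, where
  \<open>z \<le> z powr p\<close>.\<close>

lemma powr_add_le_add_powr:
  fixes x y p :: real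
  assumes "0 \<le> x" "0 \<le> y" "0 < p" "p \<le> 1"
  shows "(x + y) powr p \<le> x powr p + y powr p"
proof (cases "x + y = 0")
  case True
  then show ?thesis using assms by (simp add: add_nonneg_eq_0_iff)
next
  case False
  define s where "s = x + y"
  have s: "0 < s" using False assms by (simp add: s_def)
  have "x / s \<le> (x / s) powr p" "y / s \<le> (y / s) powr p"
    using powr_mono'[of p 1 "x / s"] powr_mono'[of p 1 "y / s"] assms s by (auto simp: s_def)
  moreover have "x / s + y / s = 1" using s by (simp add: s_def flip: add_divide_distrib)
  ultimately have "1 \<le> (x powr p + y powr p) / s powr p"
    using assms s by (simp add: powr_divide add_divide_distrib)
  then show ?thesis using s by (simp add: s_def)
qed

lemma sum_powr_le_powr_sum:
  fixes x :: "'i \<Rightarrow> real"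
  assumes "finite I" "\<And>i. i \<in> I \<Longrightarrow> 0 \<le> x i" "0 < p" "p \<le> 1"
  shows "(\<Sum>i\<in>I. x i) powr p \<le> (\<Sum>i\<in>I. x i powr p)"
  using assms(1,2)
proof (induction I)
  case (insert i I)
  have "(x i + (\<Sum>i\<in>I. x i)) powr p \<le> x i powr p + (\<Sum>i\<in>I. x i) powr p"
    using insert.prems assms by (intro powr_add_le_add_powr sum_nonneg) auto
  then show ?case using insert by simp
qed simp

text \<open>Subadditivity of the power \<alpha>/2, applied to the squares; here \<alpha> \<le> 2
  enters.\<close>

lemma L2_set_powr_le:
  fixes x :: "'i \<Rightarrow> real"
  assumes "finite I" "0 < \<alpha>" "\<alpha> \<le> 2"
  shows "L2_set x I powr \<alpha> \<le> (\<Sum>i\<in>I. \<bar>x i\<bar> powr \<alpha>)"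
proof -
  have sq: "z\<^sup>2 powr (\<alpha> / 2) = \<bar>z\<bar> powr \<alpha>" for z :: real
  proof -
    have "z\<^sup>2 = \<bar>z\<bar> powr 2" by simp
    then show ?thesis by (simp only: powr_powr) simp
  qed
  have "L2_set x I powr \<alpha> = (L2_set x I)\<^sup>2 powr (\<alpha> / 2)"
    by (simp add: sq)
  also have "(L2_set x I)\<^sup>2 = (\<Sum>i\<in>I. (x i)\<^sup>2)"
    by (simp add: L2_set_def sum_nonneg)
  also have "\<dots> powr (\<alpha> / 2) \<le> (\<Sum>i\<in>I. (x i)\<^sup>2 powr (\<alpha> / 2))"
    using assms by (intro sum_powr_le_powr_sum) auto
  finally show ?thesis by (simp add: sq)
qed

section \<open>Exceedances and the maximum\<close>

lemma abs_le_max_abs: "i < n \<Longrightarrow> \<bar>X i \<omega>\<bar> \<le> max_abs n X \<omega>"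
  unfolding max_abs_def by (intro Max_ge) auto

lemma max_abs_le_iff: "1 \<le> n \<Longrightarrow> max_abs n X \<omega> \<le> b \<longleftrightarrow> (\<forall>i<n. \<bar>X i \<omega>\<bar> \<le> b)"
  unfolding max_abs_def by (subst Max_le_iff) (auto simp: lessThan_empty_iff)

lemma borel_measurable_max_abs [measurable]:
  "(\<And>i. i < n \<Longrightarrow> X i \<in> borel_measurable M) \<Longrightarrow> max_abs n X \<in> borel_measurable M"
  unfolding max_abs_def[abs_def] by (intro borel_measurable_Max borel_measurable_abs) auto

text \<open>The events that only \<open>X i\<close> exceeds the threshold \<open>b\<close> are disjoint, and on them the maximum
  equals \<open>\<bar>X i\<bar>\<close>; independence then separates \<open>X i\<close> from the other coordinates, so that the sum of
  the exceedance moments is controlled by the moment of the maximum.\<close>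

lemma (in prob_space) sum_exceedance_le:
  fixes X :: "nat \<Rightarrow> 'a \<Rightarrow> real" and g :: "real \<Rightarrow> ennreal"
  assumes indep: "indep_vars (\<lambda>_. borel) X {..<n}" and n: "1 \<le> n"
    and g [measurable]: "g \<in> borel_measurable borel"
    and mono: "\<And>x y. 0 \<le> x \<Longrightarrow> x \<le> y \<Longrightarrow> g x \<le> g y"
  shows "(\<Sum>i<n. \<integral>\<^sup>+ \<omega>. (if b < \<bar>X i \<omega>\<bar> then g \<bar>X i \<omega>\<bar> else 0) \<partial>M) *
      (\<integral>\<^sup>+ \<omega>. (if max_abs n X \<omega> \<le> b then 1 else 0) \<partial>M) \<le> (\<integral>\<^sup>+ \<omega>. g (max_abs n X \<omega>) \<partial>M)"
proof -
  have X [measurable]: "X i \<in> borel_measurable M" if "i < n" for i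
    using indep that by (auto simp: indep_vars_def)
  define u :: "real \<Rightarrow> ennreal" where "u x = (if b < \<bar>x\<bar> then g \<bar>x\<bar> else 0)" for x
  define v :: "real \<Rightarrow> ennreal" where "v x = (if \<bar>x\<bar> \<le> b then 1 else 0)" for x
  have [measurable]: "u \<in> borel_measurable borel" "v \<in> borel_measurable borel"
    unfolding u_def v_def by measurable
  \<comment> \<open>The product of \<open>h i j (X j \<omega>)\<close> over \<open>j\<close>
    vanishes unless \<open>X i\<close> alone exceeds \<open>b\<close>.\<close>
  define h where "h i j = (if j = i then u else v)" for i j :: nat
  have [measurable]: "h i j \<in> borel_measurable borel" for i j by (simp add: h_def)
  have comp: "indep_vars (\<lambda>_. borel) (\<lambda>j \<omega>. k j (X j \<omega>)) {..<n}"
    if "\<And>j. k j \<in> borel_measurable borel" for k :: "nat \<Rightarrow> real \<Rightarrow> ennreal"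
    using indep_vars_compose2[OF indep, of k "\<lambda>_. borel"] that by auto
  have pw: "(\<Sum>i<n. \<Prod>j<n. h i j (X j \<omega>)) \<le> g (max_abs n X \<omega>)" for \<omega>
  proof (cases "\<exists>i<n. (\<Prod>j<n. h i j (X j \<omega>)) \<noteq> 0")
    case False
    then have eq: "(\<Sum>i<n. \<Prod>j<n. h i j (X j \<omega>)) = 0" by (intro sum.neutral) auto
    show ?thesis unfolding eq by simp
  next
    case True
    then obtain i where i: "i < n" "(\<Prod>j<n. h i j (X j \<omega>)) \<noteq> 0" by blast
    then have nz: "h i j (X j \<omega>) \<noteq> 0" if "j < n" for j using that by auto
    have big: "b < \<bar>X i \<omega>\<bar>" using nz[OF i(1)] by (auto simp: h_def u_def split: if_splits)
    have "(\<Prod>j<n. h k j (X j \<omega>)) = 0" if "k < n" "k \<noteq> i" for k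
      using that i(1) big by (intro prod_zero bexI[of _ i]) (auto simp: h_def v_def)
    then have "(\<Sum>i<n. \<Prod>j<n. h i j (X j \<omega>)) = (\<Prod>j<n. h i j (X j \<omega>))"
      using i(1) by (subst sum.remove[of _ i]) auto
    also have "\<dots> = u (X i \<omega>) * (\<Prod>j\<in>{..<n} - {i}. v (X j \<omega>))"
      using i(1) by (subst prod.remove[of _ i]) (auto simp: h_def intro!: prod.cong)
    also have "\<dots> \<le> u (X i \<omega>) * 1"
      by (intro mult_left_mono prod_le_1) (auto simp: v_def)
    also have "\<dots> \<le> g (max_abs n X \<omega>)"
      using mono[OF abs_ge_zero abs_le_max_abs[OF i(1), of X \<omega>]] by (simp add: u_def)
    finally show ?thesis .
  qed
  have ind: "(if max_abs n X \<omega> \<le> b then 1 else 0) = (\<Prod>j<n. v (X j \<omega>))" for \<omega>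
  proof (cases "max_abs n X \<omega> \<le> b")
    case True
    then show ?thesis using n by (auto simp: max_abs_le_iff v_def)
  next
    case False
    then obtain i where "i < n" "\<not> \<bar>X i \<omega>\<bar> \<le> b" using n by (auto simp: max_abs_le_iff)
    then have "(\<Prod>j<n. v (X j \<omega>)) = 0"
      by (intro prod_zero bexI[of _ i]) (auto simp: v_def)
    then show ?thesis using False by simp
  qed
  have q: "(\<integral>\<^sup>+ \<omega>. v (X j \<omega>) \<partial>M) \<le> 1" for j
  proof -
    have "(\<integral>\<^sup>+ \<omega>. v (X j \<omega>) \<partial>M) \<le> (\<integral>\<^sup>+ \<omega>. 1 \<partial>M)" by (intro nn_integral_mono) (auto simp: v_def)
    then show ?thesis by (simp add: emeasure_space_1)
  qed
  have "(\<Sum>i<n. \<integral>\<^sup>+ \<omega>. u (X i \<omega>) \<partial>M) * (\<integral>\<^sup>+ \<omega>. (if max_abs n X \<omega> \<le> b then 1 else 0) \<partial>M)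
      = (\<Sum>i<n. (\<integral>\<^sup>+ \<omega>. u (X i \<omega>) \<partial>M) * (\<Prod>j<n. \<integral>\<^sup>+ \<omega>. v (X j \<omega>) \<partial>M))"
    unfolding ind by (subst indep_vars_nn_integral[OF _ comp]) (auto simp: sum_distrib_right)
  also have "\<dots> \<le> (\<Sum>i<n. \<Prod>j<n. \<integral>\<^sup>+ \<omega>. h i j (X j \<omega>) \<partial>M)"
  proof (intro sum_mono)
    fix i assume i: "i \<in> {..<n}"
    have "(\<integral>\<^sup>+ \<omega>. u (X i \<omega>) \<partial>M) * (\<Prod>j<n. \<integral>\<^sup>+ \<omega>. v (X j \<omega>) \<partial>M)
        = (\<integral>\<^sup>+ \<omega>. u (X i \<omega>) \<partial>M) *
          ((\<integral>\<^sup>+ \<omega>. v (X i \<omega>) \<partial>M) * (\<Prod>j\<in>{..<n} - {i}. \<integral>\<^sup>+ \<omega>. v (X j \<omega>) \<partial>M))"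
      using i by (subst prod.remove[of _ i]) auto
    \<comment> \<open>Factor \<open>i\<close> of the probability that no coordinate exceeds
      \<open>b\<close> is replaced by 1, leaving the other coordinates next to
      \<open>u (X i \<omega>)\<close>.\<close>
    also have "\<dots> \<le> (\<integral>\<^sup>+ \<omega>. u (X i \<omega>) \<partial>M) * (1 * (\<Prod>j\<in>{..<n} - {i}. \<integral>\<^sup>+ \<omega>. v (X j \<omega>) \<partial>M))"
      by (intro mult_left_mono mult_right_mono q) auto
    also have "\<dots> = (\<Prod>j<n. \<integral>\<^sup>+ \<omega>. h i j (X j \<omega>) \<partial>M)"
      using i by (subst (2) prod.remove[of _ i]) (auto simp: h_def intro!: prod.cong)
    finally show "(\<integral>\<^sup>+ \<omega>. u (X i \<omega>) \<partial>M) * (\<Prod>j<n. \<integral>\<^sup>+ \<omega>. v (X j \<omega>) \<partial>M)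
        \<le> (\<Prod>j<n. \<integral>\<^sup>+ \<omega>. h i j (X j \<omega>) \<partial>M)" .
  qed
  also have "\<dots> = (\<Sum>i<n. \<integral>\<^sup>+ \<omega>. (\<Prod>j<n. h i j (X j \<omega>)) \<partial>M)"
    by (intro sum.cong refl indep_vars_nn_integral[symmetric] comp) auto
  also have "\<dots> = (\<integral>\<^sup>+ \<omega>. (\<Sum>i<n. \<Prod>j<n. h i j (X j \<omega>)) \<partial>M)"
    by (rule nn_integral_sum[symmetric]) measurable
  also have "\<dots> \<le> (\<integral>\<^sup>+ \<omega>. g (max_abs n X \<omega>) \<partial>M)"
    by (intro nn_integral_mono pw)
  finally show ?thesis by (simp add: u_def)
qed

text \<open>By independence the left-hand side is a product of factors at most
  \<open>1 + A i \<le> exp (A i)\<close>, where \<open>A i\<close> is the exceedance moment. The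
  \<open>A i\<close> sum to at most 4, because the moment of the maximum is at most 2 and the
  maximum stays below \<open>b\<close> with probability at least 1/2.\<close>

lemma (in prob_space) exp_moment_truncation_remainder:
  fixes X :: "nat \<Rightarrow> 'a \<Rightarrow> real"
  assumes indep: "indep_vars (\<lambda>_. borel) X {..<n}" and n: "1 \<le> n"
    and \<alpha>: "0 < \<alpha>" and \<tau>: "0 < \<tau>"
    and max: "(\<integral>\<^sup>+ \<omega>. ennreal (exp ((\<bar>max_abs n X \<omega>\<bar> / \<tau>) powr \<alpha>)) \<partial>M) \<le> 2"
  defines "b \<equiv> 2 powr (1 / \<alpha>) * \<tau>"
  shows "(\<integral>\<^sup>+ \<omega>. ennreal (exp (\<Sum>i<n. ((if b < \<bar>X i \<omega>\<bar> then \<bar>X i \<omega>\<bar> else 0) / \<tau>) powr \<alpha>)) \<partial>M)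
    \<le> ennreal (exp 4)"
proof -
  have X [measurable]: "X i \<in> borel_measurable M" if "i < n" for i
    using indep that by (auto simp: indep_vars_def)
  have [measurable]: "max_abs n X \<in> borel_measurable M" by measurable
  define g where "g x = ennreal (exp ((\<bar>x\<bar> / \<tau>) powr \<alpha>))" for x
  have [measurable]: "g \<in> borel_measurable borel" unfolding g_def by measurable
  have g_mono: "g x \<le> g y" if "0 \<le> x" "x \<le> y" for x y
    using that \<alpha> \<tau> by (auto simp: g_def intro!: powr_mono2 divide_right_mono)
  have gmax: "(\<integral>\<^sup>+ \<omega>. g (max_abs n X \<omega>) \<partial>M) \<le> 2" using max by (simp add: g_def)
  define Q where "Q = (\<integral>\<^sup>+ \<omega>. (if max_abs n X \<omega> \<le> b then 1 else 0) \<partial>M)"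
  have Q1: "Q \<le> 1"
  proof -
    have "Q \<le> (\<integral>\<^sup>+ \<omega>. 1 \<partial>M)" unfolding Q_def by (intro nn_integral_mono) auto
    then show ?thesis by (simp add: emeasure_space_1)
  qed
  have Q: "ennreal (1 / 2) \<le> Q"
  proof -
    \<comment> \<open>The factor \<open>2 powr (1 / \<alpha>)\<close> in \<open>b\<close> makes
      \<open>(b / \<tau>) powr \<alpha> = 2\<close>, and exp 2 exceeds 4.\<close>
    have "4 \<le> g x" if "b < x" for x
    proof -
      have b0: "0 < b" using \<tau> by (simp add: b_def)
      have "2 = (b / \<tau>) powr \<alpha>" using \<tau> \<alpha> by (simp add: b_def powr_powr)
      also have "\<dots> \<le> (\<bar>x\<bar> / \<tau>) powr \<alpha>"
        using that b0 \<alpha> \<tau> by (intro powr_mono2 divide_right_mono) auto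
      finally have "exp 2 \<le> exp ((\<bar>x\<bar> / \<tau>) powr \<alpha>)" by simp
      moreover have "(4::real) \<le> exp 2" using exp_lower_Taylor_quadratic[of 2] by simp
      ultimately have "4 \<le> exp ((\<bar>x\<bar> / \<tau>) powr \<alpha>)" by linarith
      then show ?thesis unfolding g_def by (simp add: ennreal_leI flip: ennreal_numeral)
    qed
    \<comment> \<open>Markov's inequality, written as \<open>4 \<le> 4 * Q + 2\<close>.\<close>
    then have "(\<integral>\<^sup>+ \<omega>. 4 \<partial>M) \<le>
        (\<integral>\<^sup>+ \<omega>. 4 * (if max_abs n X \<omega> \<le> b then 1 else 0) + g (max_abs n X \<omega>) \<partial>M)"
      by (intro nn_integral_mono) (auto simp: not_le)
    also have "\<dots> = 4 * Q + (\<integral>\<^sup>+ \<omega>. g (max_abs n X \<omega>) \<partial>M)"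
      unfolding Q_def by (subst nn_integral_add) (auto simp: nn_integral_cmult)
    also have "\<dots> \<le> 4 * Q + 2" by (intro add_left_mono gmax)
    finally have "4 \<le> 4 * Q + 2" by (simp add: emeasure_space_1)
    moreover obtain q where q: "Q = ennreal q" "0 \<le> q"
      using Q1 by (cases Q) (auto simp: top_unique)
    ultimately have "1 / 2 \<le> q"
      by (simp flip: ennreal_numeral ennreal_mult ennreal_plus)
    then show ?thesis unfolding q(1) by (rule ennreal_leI)
  qed
  define A where "A i = (\<integral>\<^sup>+ \<omega>. (if b < \<bar>X i \<omega>\<bar> then g \<bar>X i \<omega>\<bar> else 0) \<partial>M)" for i
  have "(\<Sum>i<n. A i) * Q \<le> 2"
    unfolding A_def Q_def
    by (rule order_trans[OF sum_exceedance_le[OF indep n _ g_mono] gmax]) auto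
  then have "(\<Sum>i<n. A i) * ennreal (1 / 2) \<le> 2"
    using Q by (meson mult_left_mono order_trans zero_le)
  then have "(\<Sum>i<n. A i) * ennreal (1 / 2) * 2 \<le> 2 * 2" by (rule mult_right_mono) simp
  moreover have "ennreal (1 / 2) * 2 = 1" using ennreal_mult[of "1 / 2" 2] by simp
  ultimately have A: "(\<Sum>i<n. A i) \<le> 4" by (simp add: mult.assoc)
  have fin: "A i < \<top>" if "i < n" for i
  proof -
    have "A i \<le> (\<Sum>i<n. A i)" using that by (intro member_le_sum) auto
    then show ?thesis using A by (metis ennreal_numeral_less_top order.strict_trans1 order_trans)
  qed
  define R where "R x = ennreal (exp (((if b < \<bar>x\<bar> then \<bar>x\<bar> else 0) / \<tau>) powr \<alpha>))" for x
  have [measurable]: "R \<in> borel_measurable borel" unfolding R_def by measurable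
  have "(\<integral>\<^sup>+ \<omega>. ennreal (exp (\<Sum>i<n. ((if b < \<bar>X i \<omega>\<bar> then \<bar>X i \<omega>\<bar> else 0) / \<tau>) powr \<alpha>)) \<partial>M)
      = (\<integral>\<^sup>+ \<omega>. (\<Prod>i<n. R (X i \<omega>)) \<partial>M)"
    unfolding R_def by (simp add: exp_sum prod_ennreal)
  also have "\<dots> = (\<Prod>i<n. \<integral>\<^sup>+ \<omega>. R (X i \<omega>) \<partial>M)"
    by (intro indep_vars_nn_integral indep_vars_compose2[OF indep]) auto
  also have "\<dots> \<le> (\<Prod>i<n. ennreal (exp (enn2real (A i))))"
  proof (rule prod_mono_ennreal)
    fix i assume i: "i \<in> {..<n}"
    then have i': "i < n" by simp
    \<comment> \<open>Without an exceedance the base is 0, and since \<alpha> > 0 also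
      \<open>0 powr \<alpha> = 0\<close>, so the exponential is 1.\<close>
    have "(\<integral>\<^sup>+ \<omega>. R (X i \<omega>) \<partial>M) \<le> (\<integral>\<^sup>+ \<omega>. 1 + (if b < \<bar>X i \<omega>\<bar> then g \<bar>X i \<omega>\<bar> else 0) \<partial>M)"
      using \<alpha> by (intro nn_integral_mono) (auto simp: R_def g_def)
    also have "\<dots> = 1 + A i"
      unfolding A_def using i' by (subst nn_integral_add) (auto simp: emeasure_space_1)
    also have "\<dots> = ennreal (1 + enn2real (A i))"
      using fin[OF i'] by (cases "A i") (auto simp flip: ennreal_plus ennreal_1)
    also have "\<dots> \<le> ennreal (exp (enn2real (A i)))" by (intro ennreal_leI exp_ge_add_one_self)
    finally show "(\<integral>\<^sup>+ \<omega>. R (X i \<omega>) \<partial>M) \<le> ennreal (exp (enn2real (A i)))" .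
  qed
  also have "\<dots> = ennreal (exp (\<Sum>i<n. enn2real (A i)))"
    by (simp add: exp_sum prod_ennreal)
  also have "\<dots> \<le> ennreal (exp 4)"
  proof -
    have "ennreal (\<Sum>i<n. enn2real (A i)) = (\<Sum>i<n. A i)"
      using fin by (subst sum_ennreal[symmetric]) auto
    then have "ennreal (\<Sum>i<n. enn2real (A i)) \<le> ennreal 4" using A by simp
    then show ?thesis by (subst (asm) ennreal_le_iff) (auto intro!: ennreal_leI)
  qed
  finally show ?thesis .
qed

section \<open>The exponential moment of a convex Lipschitz function\<close>

definition growth_const :: "real \<Rightarrow> real" where
  "growth_const \<alpha> = fact (nat \<lceil>1 / \<alpha>\<rceil>)"

lemma growth_const_ge_1: "1 \<le> growth_const \<alpha>"
  unfolding growth_const_def by (rule fact_ge_1)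

text \<open>A single term \<open>y ^ m / fact m\<close> of the exponential series at
  \<open>y = x powr \<alpha>\<close> suffices once \<open>m \<ge> 1 / \<alpha>\<close>. Raising the
  exponent to \<open>m\<close> requires \<open>y \<ge> 1\<close>, hence the separate case of small
  \<open>x\<close>.\<close>

lemma le_growth_const_exp_powr:
  fixes x \<alpha> :: real
  assumes "0 < \<alpha>" and "0 \<le> x"
  shows "x \<le> growth_const \<alpha> * exp (x powr \<alpha>)"
proof (cases "x \<le> 1")
  case True
  have "1 * 1 \<le> growth_const \<alpha> * exp (x powr \<alpha>)"
    using growth_const_ge_1[of \<alpha>] by (intro mult_mono) auto
  then show ?thesis using True by simp
next
  case False
  define m where "m = nat \<lceil>1 / \<alpha>\<rceil>"
  define y where "y = x powr \<alpha>"
  have y: "1 \<le> y" unfolding y_def using False assms by (intro ge_one_powr_ge_zero) auto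
  have "x = y powr (1 / \<alpha>)" using assms by (simp add: y_def powr_powr)
  also have "\<dots> \<le> y powr (real m)"
    using y by (intro powr_mono) (auto simp: m_def intro: real_nat_ceiling_ge)
  also have "\<dots> = y ^ m" using y by (simp add: powr_realpow)
  also have "\<dots> = fact m * (y ^ m /\<^sub>R fact m)" by (simp add: field_simps)
  also have "\<dots> \<le> fact m * exp y"
    using sum_le_suminf[OF summable_exp_generic[of y], of "{m}"] y
    by (intro mult_left_mono) (auto simp: exp_def)
  finally show ?thesis by (simp add: growth_const_def m_def y_def)
qed

text \<open>The first summand absorbs the scale \<open>3 * b\<close> and the factor \<open>1 / 8\<close> of the Gaussian moment
  (\<open>9\<^sup>2 \<ge> 8 * 3\<^sup>2\<close>), the second one the shift of the mean caused by the truncation.\<close>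

definition scale_const :: "real \<Rightarrow> real" where
  "scale_const \<alpha> = 9 * 2 powr (1 / \<alpha>) + growth_const \<alpha> * exp 4"

text \<open>The summands bound the contributions of the truncated variables, of the truncation error
  and of the shift of the mean.\<close>

definition moment_const :: real where
  "moment_const = exp 1 * gauss_const + exp 4 + exp 1"

text \<open>The factor 3 pays for splitting the deviation into three parts; the last factor lowers
  the exponential moment from \<open>moment_const\<close> to 2.\<close>

definition conc_const :: "real \<Rightarrow> real" where
  "conc_const \<alpha> = 3 * scale_const \<alpha> * moment_const powr (1 / \<alpha>)"

lemma gauss_const_pos: "0 < gauss_const"
  unfolding gauss_const_def by simp

lemma moment_const_ge_1: "1 \<le> moment_const"
proof -
  have "0 \<le> exp 1 * gauss_const" using gauss_const_pos by simp
  moreover have "(1::real) \<le> exp 4" by simp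
  ultimately show ?thesis unfolding moment_const_def by (smt (verit) exp_gt_zero)
qed

lemma scale_const_ge:
  "9 * 2 powr (1 / \<alpha>) \<le> scale_const \<alpha>" "growth_const \<alpha> * exp 4 \<le> scale_const \<alpha>" "1 \<le> scale_const \<alpha>"
proof -
  have p: "0 \<le> 9 * 2 powr (1 / \<alpha>)" by simp
  have "1 * 1 \<le> growth_const \<alpha> * exp 4"
    using growth_const_ge_1[of \<alpha>] by (intro mult_mono) auto
  then show "9 * 2 powr (1 / \<alpha>) \<le> scale_const \<alpha>" "growth_const \<alpha> * exp 4 \<le> scale_const \<alpha>"
    "1 \<le> scale_const \<alpha>"
    using p unfolding scale_const_def by linarith+
qed

lemma conc_const_pos: "0 < conc_const \<alpha>"
proof -
  have "0 < moment_const powr (1 / \<alpha>)" using moment_const_ge_1 by simp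
  then show ?thesis unfolding conc_const_def using scale_const_ge(3)[of \<alpha>] by simp
qed

text \<open>Lets a Gaussian moment control the moment of order \<alpha>; the additive 1 causes the
  factor \<open>exp 1\<close> in \<open>moment_const\<close>.\<close>

lemma powr_le_one_plus_square:
  fixes x \<alpha> :: real
  assumes "0 \<le> x" "0 < \<alpha>" "\<alpha> \<le> 2"
  shows "x powr \<alpha> \<le> 1 + x\<^sup>2"
proof (cases "x \<le> 1")
  case True
  then have "x powr \<alpha> \<le> 1 powr \<alpha>" using assms by (intro powr_mono2) auto
  then show ?thesis by (smt (verit) powr_one_eq_one zero_le_power2)
next
  case False
  then have "x powr \<alpha> \<le> x powr 2" using assms by (intro powr_mono) auto
  then show ?thesis using assms by simp
qed

text \<open>An average is at most the largest term. This replaces the triangle inequality, which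
  fails for the quasi-norm when \<alpha> < 1.\<close>

lemma exp_powr_third_le:
  fixes p q r x \<alpha> :: real
  assumes "0 < \<alpha>" "0 \<le> p" "0 \<le> q" "0 \<le> r" "0 \<le> x" "3 * x \<le> p + q + r"
  shows "exp (x powr \<alpha>) \<le> exp (p powr \<alpha>) + exp (q powr \<alpha>) + exp (r powr \<alpha>)"
proof -
  have *: "exp (x powr \<alpha>) \<le> exp (y powr \<alpha>)" if "x \<le> y" for y
    using assms that by (simp add: powr_mono2)
  have "x \<le> p \<or> x \<le> q \<or> x \<le> r" using assms by linarith
  then show ?thesis
    using *[of p] *[of q] *[of r] exp_gt_zero[of "p powr \<alpha>"] exp_gt_zero[of "q powr \<alpha>"]
      exp_gt_zero[of "r powr \<alpha>"] by linarith
qed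

text \<open>Convexity of \<open>exp\<close> between 0 and \<xi>. If the mean of
  \<open>exp \<xi>\<close> is at most \<open>a\<close>, that of \<open>exp (\<xi> / a)\<close> is at
  most 2 - 1/a.\<close>

lemma exp_divide_le:
  fixes \<xi> a :: real
  assumes "1 \<le> a"
  shows "exp (\<xi> / a) \<le> (1 - 1 / a) + 1 / a * exp \<xi>"
  using assms convex_onD[OF exp_convex, of "1 / a" 0 \<xi>] by simp

lemma (in prob_space) exp_moment_lipschitz_function:
  fixes X :: "nat \<Rightarrow> 'a \<Rightarrow> real"
  assumes indep: "indep_vars (\<lambda>_. borel) X {..<n}" and n: "1 \<le> n"
    and \<alpha>: "0 < \<alpha>" "\<alpha> \<le> 2" and \<tau>: "0 < \<tau>"
    and max: "(\<integral>\<^sup>+ \<omega>. ennreal (exp ((\<bar>max_abs n X \<omega>\<bar> / \<tau>) powr \<alpha>)) \<partial>M) \<le> 2"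
    and F: "convex_lipschitz n 1 F"
  defines "G \<equiv> \<lambda>\<omega>. F (\<lambda>i\<in>{..<n}. X i \<omega>)"
  shows "(\<integral>\<^sup>+ \<omega>. ennreal (exp ((\<bar>G \<omega> - expectation G\<bar> / (conc_const \<alpha> * \<tau>)) powr \<alpha>)) \<partial>M) \<le> 2"
proof -
  have X [measurable]: "X i \<in> borel_measurable M" if "i < n" for i
    using indep that by (auto simp: indep_vars_def)
  define b where "b = 2 powr (1 / \<alpha>) * \<tau>"
  have b: "0 < b" using \<tau> by (simp add: b_def)
  \<comment> \<open>Applied to each coordinate separately, the truncation preserves independence;
    \<open>R i\<close> is the absolute value of what it removes from \<open>X i\<close>.\<close>
  define k where "k x = (if \<bar>x\<bar> \<le> b then x else 0)" for x :: real
  have [measurable]: "k \<in> borel_measurable borel" unfolding k_def by measurable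
  define R where "R i \<omega> = (if b < \<bar>X i \<omega>\<bar> then \<bar>X i \<omega>\<bar> else 0)" for i \<omega>
  have [measurable]: "R i \<in> borel_measurable M" if "i < n" for i
    unfolding R_def using X[OF that] by measurable
  define W where "W \<omega> = L2_set (\<lambda>i. R i \<omega>) {..<n}" for \<omega>
  have Wm [measurable]: "W \<in> borel_measurable M" unfolding W_def L2_set_def by measurable
  have W0: "0 \<le> W \<omega>" for \<omega> by (simp add: W_def)
  define H where "H \<omega> = F (\<lambda>i\<in>{..<n}. k (X i \<omega>))" for \<omega>
  have Fm [measurable]: "F \<in> borel_measurable (PiM {..<n} (\<lambda>_. borel))"
    by (rule measurable_lipschitz[OF convex_lipschitzD(2)[OF F]])
  have [measurable]: "(\<lambda>\<omega>. \<lambda>i\<in>{..<n}. X i \<omega>) \<in> measurable M (PiM {..<n} (\<lambda>_. borel))"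
    by (intro measurable_restrict) auto
  have Gm [measurable]: "G \<in> borel_measurable M" unfolding G_def by measurable
  have "indep_vars (\<lambda>_. borel) (\<lambda>i \<omega>. k (X i \<omega>)) {..<n}"
    by (rule indep_vars_compose2[OF indep]) measurable
  note bcc = bounded_convex_concentration[OF this n _ b F, folded H_def]
  have "\<bar>k x\<bar> \<le> b" for x using b by (simp add: k_def)
  then have Hint: "integrable M H" and
    Hexp: "(\<integral>\<^sup>+ \<omega>. ennreal (exp (((H \<omega> - expectation H) / (3 * b))\<^sup>2 / 8)) \<partial>M) \<le> ennreal gauss_const"
    using bcc by auto
  note [measurable] = borel_measurable_integrable[OF Hint]
  have GH: "\<bar>G \<omega> - H \<omega>\<bar> \<le> W \<omega>" for \<omega>
  proof -
    have "L2_set (\<lambda>i. (\<lambda>i\<in>{..<n}. X i \<omega>) i - (\<lambda>i\<in>{..<n}. k (X i \<omega>)) i) {..<n} = W \<omega>"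
      unfolding W_def L2_set_def
      by (intro arg_cong[of _ _ sqrt] sum.cong) (auto simp: R_def k_def)
    then show ?thesis
      using convex_lipschitzD(2)[OF F, of "\<lambda>i\<in>{..<n}. X i \<omega>" "\<lambda>i\<in>{..<n}. k (X i \<omega>)"]
      by (simp add: G_def H_def)
  qed
  have Wexp: "(\<integral>\<^sup>+ \<omega>. ennreal (exp ((W \<omega> / \<tau>) powr \<alpha>)) \<partial>M) \<le> ennreal (exp 4)"
  proof -
    have "(W \<omega> / \<tau>) powr \<alpha> \<le> (\<Sum>i<n. (R i \<omega> / \<tau>) powr \<alpha>)" for \<omega>
    proof -
      have "W \<omega> / \<tau> = L2_set (\<lambda>i. R i \<omega> / \<tau>) {..<n}"
        using L2_set_left_distrib[of "1 / \<tau>" "\<lambda>i. R i \<omega>" "{..<n}"] \<tau> by (simp add: W_def)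
      moreover have "\<bar>R i \<omega> / \<tau>\<bar> = R i \<omega> / \<tau>" for i using \<tau> by (simp add: R_def)
      ultimately show ?thesis
        using L2_set_powr_le[of "{..<n}" \<alpha> "\<lambda>i. R i \<omega> / \<tau>"] \<alpha> by simp
    qed
    then have "(\<integral>\<^sup>+ \<omega>. ennreal (exp ((W \<omega> / \<tau>) powr \<alpha>)) \<partial>M)
        \<le> (\<integral>\<^sup>+ \<omega>. ennreal (exp (\<Sum>i<n. (R i \<omega> / \<tau>) powr \<alpha>)) \<partial>M)"
      by (intro nn_integral_mono ennreal_leI) simp
    also have "\<dots> \<le> ennreal (exp 4)"
      using exp_moment_truncation_remainder[OF indep n \<alpha>(1) \<tau> max] by (simp add: R_def b_def)
    finally show ?thesis .
  qed
  \<comment> \<open>The first moment of \<open>W\<close> bounds the shift of the mean and also shows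
    that \<open>G\<close> is integrable.\<close>
  have Wnn: "(\<integral>\<^sup>+ \<omega>. ennreal (W \<omega>) \<partial>M) \<le> ennreal (\<tau> * growth_const \<alpha> * exp 4)"
  proof -
    have "ennreal (W \<omega>) \<le> ennreal (\<tau> * growth_const \<alpha>) * ennreal (exp ((W \<omega> / \<tau>) powr \<alpha>))" for \<omega>
    proof -
      have "W \<omega> \<le> \<tau> * growth_const \<alpha> * exp ((W \<omega> / \<tau>) powr \<alpha>)"
        using le_growth_const_exp_powr[OF \<alpha>(1), of "W \<omega> / \<tau>"] W0[of \<omega>] \<tau> by (simp add: field_simps)
      then show ?thesis
        using \<tau> growth_const_ge_1[of \<alpha>] by (subst ennreal_mult[symmetric]) (auto intro!: ennreal_leI)
    qed
    then have "(\<integral>\<^sup>+ \<omega>. ennreal (W \<omega>) \<partial>M) \<le>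
        (\<integral>\<^sup>+ \<omega>. ennreal (\<tau> * growth_const \<alpha>) * ennreal (exp ((W \<omega> / \<tau>) powr \<alpha>)) \<partial>M)"
      by (intro nn_integral_mono)
    also have "\<dots> = ennreal (\<tau> * growth_const \<alpha>) * (\<integral>\<^sup>+ \<omega>. ennreal (exp ((W \<omega> / \<tau>) powr \<alpha>)) \<partial>M)"
      by (rule nn_integral_cmult) measurable
    also have "\<dots> \<le> ennreal (\<tau> * growth_const \<alpha>) * ennreal (exp 4)"
      by (intro mult_left_mono Wexp) simp
    finally show ?thesis using \<tau> growth_const_ge_1[of \<alpha>] by (simp add: ennreal_mult)
  qed
  have Wint: "integrable M W"
    using order_le_less_trans[OF Wnn ennreal_less_top] W0
    by (intro integrableI_nonneg) (auto simp: less_top)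
  have EW: "expectation W \<le> \<tau> * growth_const \<alpha> * exp 4"
    using \<tau> growth_const_ge_1[of \<alpha>] by (intro integral_real_bounded Wnn) simp
  have GHint: "integrable M (\<lambda>\<omega>. G \<omega> - H \<omega>)"
    using GH by (intro Bochner_Integration.integrable_bound[OF Wint]) (auto simp: W0)
  then have Gint: "integrable M G"
    using Bochner_Integration.integrable_add[OF GHint Hint] by simp
  have EGH: "\<bar>expectation G - expectation H\<bar> \<le> \<tau> * growth_const \<alpha> * exp 4"
  proof -
    have "\<bar>expectation (\<lambda>\<omega>. G \<omega> - H \<omega>)\<bar> \<le> expectation (\<lambda>\<omega>. \<bar>G \<omega> - H \<omega>\<bar>)"
      by (rule integral_abs_bound)
    also have "\<dots> \<le> expectation W"
      using GHint Wint GH by (intro integral_mono) auto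
    finally show ?thesis using EW Gint Hint by simp
  qed
  define S where "S = scale_const \<alpha>"
  have S: "9 * b \<le> S * \<tau>" "growth_const \<alpha> * exp 4 \<le> S" "1 \<le> S"
    using scale_const_ge[of \<alpha>] \<tau> by (auto simp: S_def b_def)
  define x where "x \<omega> = \<bar>G \<omega> - expectation G\<bar> / (3 * S * \<tau>)" for \<omega>
  define e where "e \<omega> = exp (((H \<omega> - expectation H) / (3 * b))\<^sup>2 / 8)" for \<omega>
  define w where "w \<omega> = exp ((W \<omega> / \<tau>) powr \<alpha>)" for \<omega>
  have pw: "exp (x \<omega> powr \<alpha>) \<le> exp 1 * e \<omega> + w \<omega> + exp 1" for \<omega>
  proof -
    \<comment> \<open>In units of \<open>S * \<tau>\<close>: the deviation of the truncated
      function, the truncation error, and the shift of the mean. The scale is chosen so that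
      \<open>r \<le> 1\<close>.\<close>
    define p q r where "p = \<bar>H \<omega> - expectation H\<bar> / (S * \<tau>)" and "q = W \<omega> / (S * \<tau>)"
      and "r = growth_const \<alpha> * exp 4 / S"
    have nn: "0 \<le> p" "0 \<le> q" "0 \<le> r" "0 \<le> x \<omega>"
      using S \<tau> W0[of \<omega>] growth_const_ge_1[of \<alpha>] by (auto simp: p_def q_def r_def x_def)
    have "\<bar>G \<omega> - expectation G\<bar> \<le> \<bar>H \<omega> - expectation H\<bar> + W \<omega> + \<tau> * growth_const \<alpha> * exp 4"
      using GH[of \<omega>] EGH by linarith
    then have "3 * x \<omega> \<le> (\<bar>H \<omega> - expectation H\<bar> + W \<omega> + \<tau> * growth_const \<alpha> * exp 4) / (S * \<tau>)"
      using S \<tau> by (simp add: x_def divide_right_mono)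
    also have "\<dots> = p + q + r"
      using S \<tau> by (simp add: p_def q_def r_def add_divide_distrib)
    finally have "exp (x \<omega> powr \<alpha>) \<le> exp (p powr \<alpha>) + exp (q powr \<alpha>) + exp (r powr \<alpha>)"
      using nn \<alpha> by (intro exp_powr_third_le)
    also have "exp (p powr \<alpha>) \<le> exp 1 * e \<omega>"
    proof -
      have "p powr \<alpha> \<le> 1 + p\<^sup>2" using nn \<alpha> by (intro powr_le_one_plus_square)
      also have "p\<^sup>2 \<le> ((H \<omega> - expectation H) / (3 * b))\<^sup>2 / 8"
      proof -
        have "72 * b\<^sup>2 \<le> (9 * b)\<^sup>2" by (simp add: power2_eq_square)
        also have "\<dots> \<le> (S * \<tau>)\<^sup>2" using S b by (intro power_mono) auto
        finally have "(H \<omega> - expectation H)\<^sup>2 / (S * \<tau>)\<^sup>2 \<le> (H \<omega> - expectation H)\<^sup>2 / (72 * b\<^sup>2)"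
          using b S \<tau> by (intro divide_left_mono mult_pos_pos zero_less_power) auto
        then show ?thesis by (simp add: p_def power_divide power_mult_distrib)
      qed
      finally show ?thesis by (simp add: e_def flip: exp_add)
    qed
    also have "exp (q powr \<alpha>) \<le> w \<omega>"
    proof -
      have "q \<le> W \<omega> / \<tau>"
        unfolding q_def using S \<tau> W0[of \<omega>] by (intro divide_left_mono) auto
      then show ?thesis using nn \<alpha> by (simp add: w_def powr_mono2)
    qed
    also have "exp (r powr \<alpha>) \<le> exp 1"
    proof -
      have "r \<le> 1" using S by (simp add: r_def)
      then have "r powr \<alpha> \<le> 1 powr \<alpha>" using nn \<alpha> by (intro powr_mono2) auto
      then show ?thesis by simp
    qed
    finally show ?thesis by simp
  qed
  have xmom: "(\<integral>\<^sup>+ \<omega>. ennreal (exp (x \<omega> powr \<alpha>)) \<partial>M) \<le> ennreal moment_const"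
  proof -
    have "(\<integral>\<^sup>+ \<omega>. ennreal (exp (x \<omega> powr \<alpha>)) \<partial>M) \<le>
        (\<integral>\<^sup>+ \<omega>. ennreal (exp 1) * ennreal (e \<omega>) + ennreal (w \<omega>) + ennreal (exp 1) \<partial>M)"
    proof (intro nn_integral_mono)
      fix \<omega>
      have "0 \<le> e \<omega>" "0 \<le> w \<omega>" by (auto simp: e_def w_def)
      then show "ennreal (exp (x \<omega> powr \<alpha>)) \<le>
          ennreal (exp 1) * ennreal (e \<omega>) + ennreal (w \<omega>) + ennreal (exp 1)"
        using pw[of \<omega>] by (simp add: ennreal_leI flip: ennreal_mult ennreal_plus)
    qed
    also have "\<dots> = ennreal (exp 1) * (\<integral>\<^sup>+ \<omega>. ennreal (e \<omega>) \<partial>M) + (\<integral>\<^sup>+ \<omega>. ennreal (w \<omega>) \<partial>M) + ennreal (exp 1)"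
      unfolding e_def w_def
      by (subst nn_integral_add nn_integral_cmult; simp add: emeasure_space_1)+
    also have "\<dots> \<le> ennreal (exp 1) * ennreal gauss_const + ennreal (exp 4) + ennreal (exp 1)"
      using Hexp Wexp unfolding e_def w_def by (intro add_mono mult_left_mono) auto
    also have "\<dots> = ennreal moment_const"
      unfolding moment_const_def using gauss_const_pos by (simp flip: ennreal_mult ennreal_plus)
    finally show ?thesis .
  qed
  define A where "A = moment_const"
  have A: "1 \<le> A" unfolding A_def by (rule moment_const_ge_1)
  \<comment> \<open>Dividing by \<open>A powr (1 / \<alpha>)\<close> divides the power of order
    \<alpha> by \<open>A\<close>, which prepares for \<open>exp_divide_le\<close>.\<close>
  have "(\<bar>G \<omega> - expectation G\<bar> / (conc_const \<alpha> * \<tau>)) powr \<alpha> = x \<omega> powr \<alpha> / A" for \<omega>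
  proof -
    have "\<bar>G \<omega> - expectation G\<bar> / (conc_const \<alpha> * \<tau>) = x \<omega> / A powr (1 / \<alpha>)"
      by (simp add: x_def conc_const_def S_def A_def)
    moreover have "0 \<le> x \<omega>" using S \<tau> by (simp add: x_def)
    ultimately show ?thesis using A \<alpha> by (simp add: powr_divide powr_powr)
  qed
  then have "(\<integral>\<^sup>+ \<omega>. ennreal (exp ((\<bar>G \<omega> - expectation G\<bar> / (conc_const \<alpha> * \<tau>)) powr \<alpha>)) \<partial>M)
      = (\<integral>\<^sup>+ \<omega>. ennreal (exp (x \<omega> powr \<alpha> / A)) \<partial>M)" by simp
  also have "\<dots> \<le> (\<integral>\<^sup>+ \<omega>. ennreal (1 - 1 / A) + ennreal (1 / A) * ennreal (exp (x \<omega> powr \<alpha>)) \<partial>M)"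
  proof (intro nn_integral_mono)
    fix \<omega>
    have "ennreal (exp (x \<omega> powr \<alpha> / A)) \<le> ennreal ((1 - 1 / A) + 1 / A * exp (x \<omega> powr \<alpha>))"
      by (intro ennreal_leI exp_divide_le A)
    also have "\<dots> = ennreal (1 - 1 / A) + ennreal (1 / A) * ennreal (exp (x \<omega> powr \<alpha>))"
      using A by (subst ennreal_plus) (auto simp: ennreal_mult[symmetric])
    finally show "ennreal (exp (x \<omega> powr \<alpha> / A)) \<le>
        ennreal (1 - 1 / A) + ennreal (1 / A) * ennreal (exp (x \<omega> powr \<alpha>))" .
  qed
  also have "\<dots> = ennreal (1 - 1 / A) + ennreal (1 / A) * (\<integral>\<^sup>+ \<omega>. ennreal (exp (x \<omega> powr \<alpha>)) \<partial>M)"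
    unfolding x_def by (subst nn_integral_add nn_integral_cmult; simp add: emeasure_space_1)+
  also have "\<dots> \<le> ennreal (1 - 1 / A) + ennreal (1 / A) * ennreal A"
    using xmom by (intro add_left_mono mult_left_mono) (auto simp: A_def)
  also have "\<dots> = ennreal ((1 - 1 / A) + 1 / A * A)"
    using A by (subst ennreal_plus) (auto simp: ennreal_mult[symmetric])
  also have "\<dots> \<le> ennreal 2" using A by (intro ennreal_leI) simp
  finally show ?thesis by simp
qed

section \<open>Orlicz norms and tails\<close>

lemma convex_lipschitz_restrict:
  assumes "convex_Rn n f" "lipschitz1_Rn n f"
  shows "convex_lipschitz n 1 (\<lambda>x. f (restrict x {..<n}))"
proof -
  have Rn: "restrict z {..<n} \<in> Rn n" for z by (simp add: Rn_def)
  show ?thesis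
    unfolding convex_lipschitz_def
  proof (intro conjI allI ballI)
    fix x y :: "nat \<Rightarrow> real" and u :: real assume u: "u \<in> {0..1}"
    have eq: "restrict (\<lambda>i. (1 - u) * x i + u * y i) {..<n} =
        (\<lambda>i\<in>{..<n}. (1 - u) * restrict x {..<n} i + u * restrict y {..<n} i)"
      by (auto simp: restrict_def)
    show "f (restrict (\<lambda>i. (1 - u) * x i + u * y i) {..<n})
        \<le> (1 - u) * f (restrict x {..<n}) + u * f (restrict y {..<n})"
      unfolding eq using assms(1) Rn u unfolding convex_Rn_def by blast
  next
    fix x y :: "nat \<Rightarrow> real"
    have "L2_set (\<lambda>i. restrict x {..<n} i - restrict y {..<n} i) {..<n} = L2_set (\<lambda>i. x i - y i) {..<n}"
      by (rule L2_set_cong) auto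
    moreover have "\<bar>f (restrict x {..<n}) - f (restrict y {..<n})\<bar> \<le>
        L2_set (\<lambda>i. restrict x {..<n} i - restrict y {..<n} i) {..<n}"
      using assms(2) Rn unfolding lipschitz1_Rn_def by blast
    ultimately show "\<bar>f (restrict x {..<n}) - f (restrict y {..<n})\<bar> \<le>
        1 * L2_set (\<lambda>i. x i - y i) {..<n}" by simp
  qed
qed

lemma admissible_measurable:
  assumes "admissible \<alpha> M n X f"
  shows "i < n \<Longrightarrow> X i \<in> borel_measurable M"
    and "random_vector n X \<in> measurable M (PiM {..<n} (\<lambda>_. borel))"
    and "f \<in> borel_measurable (PiM {..<n} (\<lambda>_. borel))"
proof -
  interpret prob_space M using assms by (simp add: admissible_def)
  have indep: "indep_vars (\<lambda>_. borel) X {..<n}" using assms by (simp add: admissible_def)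
  then show X: "X i \<in> borel_measurable M" if "i < n" for i
    using that by (auto simp: indep_vars_def)
  then show "random_vector n X \<in> measurable M (PiM {..<n} (\<lambda>_. borel))"
    unfolding random_vector_def[abs_def] by (intro measurable_restrict) auto
  have "convex_lipschitz n 1 (\<lambda>x. f (restrict x {..<n}))"
    using assms by (intro convex_lipschitz_restrict) (auto simp: admissible_def)
  from measurable_lipschitz[OF convex_lipschitzD(2)[OF this]]
  show "f \<in> borel_measurable (PiM {..<n} (\<lambda>_. borel))"
    by (rule measurable_cong[THEN iffD1, rotated]) (auto simp: space_PiM PiE_def extensional_restrict)
qed

text \<open>The scales competing in the infimum. Estimates are proved for each such scale, so
  attainment of the infimum never has to be discussed.\<close>

definition orlicz_bound :: "real \<Rightarrow> 'a measure \<Rightarrow> ('a \<Rightarrow> real) \<Rightarrow> real \<Rightarrow> bool" where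
  "orlicz_bound \<alpha> M Y s \<longleftrightarrow> 0 < s \<and> (\<integral>\<^sup>+ \<omega>. ennreal (exp ((\<bar>Y \<omega>\<bar> / s) powr \<alpha>)) \<partial>M) \<le> 2"

lemma orlicz_norm_eq: "orlicz_norm \<alpha> M Y = Inf (ennreal ` {s. orlicz_bound \<alpha> M Y s})"
  by (simp add: orlicz_norm_def orlicz_bound_def)

lemma orlicz_norm_lessD:
  assumes "orlicz_norm \<alpha> M Y < x"
  obtains s where "orlicz_bound \<alpha> M Y s" "ennreal s < x"
  using assms unfolding orlicz_norm_eq Inf_less_iff by auto

lemma orlicz_bound_centered:
  assumes adm: "admissible \<alpha> M n X f" and \<alpha>: "0 < \<alpha>" "\<alpha> \<le> 2"
    and s: "orlicz_bound \<alpha> M (max_abs n X) s"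
  shows "orlicz_bound \<alpha> M (centered M (\<lambda>\<omega>. f (random_vector n X \<omega>))) (conc_const \<alpha> * s)"
proof -
  interpret prob_space M using adm by (simp add: admissible_def)
  have F: "convex_lipschitz n 1 (\<lambda>x. f (restrict x {..<n}))"
    using adm by (intro convex_lipschitz_restrict) (auto simp: admissible_def)
  have eq: "f (restrict (\<lambda>i\<in>{..<n}. X i \<omega>) {..<n}) = f (random_vector n X \<omega>)" for \<omega>
    by (simp add: random_vector_def)
  have "indep_vars (\<lambda>_. borel) X {..<n}" "1 \<le> n" using adm by (auto simp: admissible_def)
  from exp_moment_lipschitz_function[OF this \<alpha> _ _ F, of s] s conc_const_pos[of \<alpha>]
  show ?thesis unfolding eq by (simp add: orlicz_bound_def centered_def)
qed

text \<open>Markov's inequality for \<open>exp ((\<bar>Z\<bar> / s) powr \<alpha>)\<close>.\<close>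

lemma (in prob_space) orlicz_bound_tail:
  assumes [measurable]: "Z \<in> borel_measurable M" and s: "orlicz_bound \<alpha> M Z s"
    and "0 \<le> t" "0 < \<alpha>"
  shows "prob {\<omega> \<in> space M. \<bar>Z \<omega>\<bar> > t} \<le> 2 * exp (- ((t / s) powr \<alpha>))"
proof -
  let ?A = "{\<omega> \<in> space M. \<bar>Z \<omega>\<bar> > t}"
  have s0: "0 < s" using s by (simp add: orlicz_bound_def)
  have "emeasure M ?A = (\<integral>\<^sup>+ \<omega>. indicator ?A \<omega> \<partial>M)" by simp
  also have "\<dots> \<le> (\<integral>\<^sup>+ \<omega>. ennreal (exp (- ((t / s) powr \<alpha>))) *
      ennreal (exp ((\<bar>Z \<omega>\<bar> / s) powr \<alpha>)) \<partial>M)"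
  proof (intro nn_integral_mono)
    fix \<omega>
    show "indicator ?A \<omega> \<le> ennreal (exp (- ((t / s) powr \<alpha>))) * ennreal (exp ((\<bar>Z \<omega>\<bar> / s) powr \<alpha>))"
    proof (cases "\<omega> \<in> ?A")
      case True
      then have "(t / s) powr \<alpha> \<le> (\<bar>Z \<omega>\<bar> / s) powr \<alpha>"
        using assms s0 by (intro powr_mono2 divide_right_mono) auto
      then have "1 \<le> exp (- ((t / s) powr \<alpha>)) * exp ((\<bar>Z \<omega>\<bar> / s) powr \<alpha>)"
        by (simp flip: exp_add)
      then have "1 \<le> ennreal (exp (- ((t / s) powr \<alpha>)) * exp ((\<bar>Z \<omega>\<bar> / s) powr \<alpha>))"
        by (simp only: ennreal_ge_1)
      then show ?thesis using True by (simp add: ennreal_mult)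
    qed simp
  qed
  also have "\<dots> = ennreal (exp (- ((t / s) powr \<alpha>))) *
      (\<integral>\<^sup>+ \<omega>. ennreal (exp ((\<bar>Z \<omega>\<bar> / s) powr \<alpha>)) \<partial>M)"
    by (rule nn_integral_cmult) measurable
  also have "\<dots> \<le> ennreal (exp (- ((t / s) powr \<alpha>))) * 2"
    using s by (intro mult_left_mono) (auto simp: orlicz_bound_def)
  also have "\<dots> = ennreal (2 * exp (- ((t / s) powr \<alpha>)))"
    by (simp add: ennreal_mult mult.commute)
  finally show ?thesis by (simp add: emeasure_eq_measure)
qed

text \<open>The mean of \<bar>Z\<bar> is at most \<open>2 * s * growth_const \<alpha>\<close> for
  arbitrarily small scales \<open>s\<close>. This settles the degenerate case in which the tail
  bound is 0.\<close>

lemma (in prob_space) AE_zero_of_orlicz_norm_zero: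
  assumes [measurable]: "Z \<in> borel_measurable M" and zero: "orlicz_norm \<alpha> M Z = 0" and \<alpha>: "0 < \<alpha>"
  shows "AE \<omega> in M. Z \<omega> = 0"
proof -
  have le: "(\<integral>\<^sup>+ \<omega>. ennreal \<bar>Z \<omega>\<bar> \<partial>M) \<le> ennreal (s * growth_const \<alpha>) * 2"
    if s: "orlicz_bound \<alpha> M Z s" for s
  proof -
    have s0: "0 < s" using s by (simp add: orlicz_bound_def)
    have "(\<integral>\<^sup>+ \<omega>. ennreal \<bar>Z \<omega>\<bar> \<partial>M) \<le>
        (\<integral>\<^sup>+ \<omega>. ennreal (s * growth_const \<alpha>) * ennreal (exp ((\<bar>Z \<omega>\<bar> / s) powr \<alpha>)) \<partial>M)"
    proof (intro nn_integral_mono)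
      fix \<omega>
      have "\<bar>Z \<omega>\<bar> \<le> s * growth_const \<alpha> * exp ((\<bar>Z \<omega>\<bar> / s) powr \<alpha>)"
        using le_growth_const_exp_powr[OF \<alpha>, of "\<bar>Z \<omega>\<bar> / s"] s0 by (simp add: field_simps)
      then show "ennreal \<bar>Z \<omega>\<bar> \<le> ennreal (s * growth_const \<alpha>) * ennreal (exp ((\<bar>Z \<omega>\<bar> / s) powr \<alpha>))"
        using s0 growth_const_ge_1[of \<alpha>] by (subst ennreal_mult[symmetric]) (auto intro!: ennreal_leI)
    qed
    also have "\<dots> = ennreal (s * growth_const \<alpha>) * (\<integral>\<^sup>+ \<omega>. ennreal (exp ((\<bar>Z \<omega>\<bar> / s) powr \<alpha>)) \<partial>M)"
      by (rule nn_integral_cmult) measurable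
    also have "\<dots> \<le> ennreal (s * growth_const \<alpha>) * 2"
      using s by (intro mult_left_mono) (auto simp: orlicz_bound_def)
    finally show ?thesis .
  qed
  have "(\<integral>\<^sup>+ \<omega>. ennreal \<bar>Z \<omega>\<bar> \<partial>M) \<le> 0 + ennreal e" if e: "0 < e" for e
  proof -
    let ?d = "e / (2 * growth_const \<alpha>)"
    have g: "0 < growth_const \<alpha>" using growth_const_ge_1[of \<alpha>] by simp
    have d: "0 < ?d" using e g by simp
    then have "orlicz_norm \<alpha> M Z < ennreal ?d" unfolding zero by simp
    then obtain s where s: "orlicz_bound \<alpha> M Z s" "ennreal s < ennreal ?d"
      by (rule orlicz_norm_lessD)
    then have sd: "s < ?d" "0 < s" by (auto simp: orlicz_bound_def ennreal_less_iff)
    have "ennreal (s * growth_const \<alpha>) * 2 = ennreal (s * growth_const \<alpha> * 2)"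
      using sd g by (subst ennreal_mult) auto
    also have "\<dots> \<le> ennreal e"
      using sd g by (intro ennreal_leI) (simp add: field_simps)
    finally show ?thesis using le[OF s(1)] by simp
  qed
  then have "(\<integral>\<^sup>+ \<omega>. ennreal \<bar>Z \<omega>\<bar> \<partial>M) \<le> 0" by (rule ennreal_le_epsilon)
  then show ?thesis by (simp add: nn_integral_0_iff_AE)
qed

section \<open>The two constants\<close>

lemma norm_constant_conc_const:
  assumes \<alpha>: "0 < \<alpha>" "\<alpha> \<le> 2"
  shows "norm_constant TYPE('a) \<alpha> (conc_const \<alpha>)"
  unfolding norm_constant_def
proof (intro allI impI)
  fix M :: "'a measure" and n X f assume adm: "admissible \<alpha> M n X f"
  define C where "C = conc_const \<alpha>"
  have C: "0 < C" unfolding C_def by (rule conc_const_pos)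
  let ?O = "orlicz_norm \<alpha> M (centered M (\<lambda>\<omega>. f (random_vector n X \<omega>)))"
  have inv: "ennreal C * ennreal (1 / C) = 1" using C by (simp flip: ennreal_mult)
  \<comment> \<open>With the constant moved to the left, the infimum stands alone on the right and
    may be compared scale by scale.\<close>
  have "?O * ennreal (1 / C) \<le> orlicz_norm \<alpha> M (max_abs n X)"
    unfolding orlicz_norm_eq[of \<alpha> M "max_abs n X"]
  proof (rule Inf_greatest)
    fix y assume "y \<in> ennreal ` {s. orlicz_bound \<alpha> M (max_abs n X) s}"
    then obtain s where y: "y = ennreal s" and s: "orlicz_bound \<alpha> M (max_abs n X) s" by auto
    have "?O \<le> ennreal (C * s)"
      unfolding orlicz_norm_eq C_def
      by (intro Inf_lower imageI CollectI orlicz_bound_centered[OF adm \<alpha> s])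
    then have "?O * ennreal (1 / C) \<le> ennreal (C * s) * ennreal (1 / C)"
      by (rule mult_right_mono) simp
    also have "\<dots> = y" using C s by (simp add: y orlicz_bound_def flip: ennreal_mult)
    finally show "?O * ennreal (1 / C) \<le> y" .
  qed
  then have "ennreal C * (?O * ennreal (1 / C)) \<le> ennreal C * orlicz_norm \<alpha> M (max_abs n X)"
    by (rule mult_left_mono) simp
  then show "?O \<le> ennreal (conc_const \<alpha>) * orlicz_norm \<alpha> M (max_abs n X)"
    unfolding C_def[symmetric] mult.left_commute[of "ennreal C"] inv by simp
qed

lemma tail_constant_conc_const:
  assumes \<alpha>: "0 < \<alpha>" "\<alpha> \<le> 2"
  shows "tail_constant TYPE('a) \<alpha> ((2 * conc_const \<alpha>) powr \<alpha>)"
  unfolding tail_constant_def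
proof (intro allI impI)
  fix M :: "'a measure" and n X f and t :: real
  assume adm: "admissible \<alpha> M n X f" and t: "0 \<le> t"
  interpret prob_space M using adm by (simp add: admissible_def)
  note [measurable] = admissible_measurable[OF adm]
  define Z where "Z = centered M (\<lambda>\<omega>. f (random_vector n X \<omega>))"
  have [measurable]: "Z \<in> borel_measurable M"
    unfolding Z_def centered_def[abs_def] by measurable
  define K where "K = orlicz_norm \<alpha> M (max_abs n X)"
  define C where "C = conc_const \<alpha>"
  have C: "0 < C" unfolding C_def by (rule conc_const_pos)
  have "prob {\<omega> \<in> space M. \<bar>Z \<omega>\<bar> > t} \<le> tail_rhs \<alpha> ((2 * C) powr \<alpha>) K t"
  proof (cases K)
    \<comment> \<open>Here \<open>enn2real\<close> returns 0 and the division by zero turns the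
      right-hand side into 2.\<close>
    case top
    have "prob {\<omega> \<in> space M. \<bar>Z \<omega>\<bar> > t} \<le> 1" by (rule prob_le_1)
    then have "prob {\<omega> \<in> space M. \<bar>Z \<omega>\<bar> > t} \<le> 2" by linarith
    then show ?thesis using top by (simp add: tail_rhs_def)
  next
    case (real k)
    show ?thesis
    proof (cases "k = 0")
      case True
      then have K0: "K = 0" using real by simp
      have "orlicz_norm \<alpha> M Z \<le> ennreal C * K"
        using norm_constant_conc_const[OF \<alpha>, where 'a = 'a] adm
        unfolding norm_constant_def Z_def K_def C_def by blast
      then have "orlicz_norm \<alpha> M Z = 0" using K0 by simp
      from AE_zero_of_orlicz_norm_zero[OF _ this \<alpha>(1)]
      have "AE \<omega> in M. Z \<omega> = 0" by simp
      then have "AE \<omega> in M. \<not> \<bar>Z \<omega>\<bar> > t" by eventually_elim (use t in simp)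
      then have "prob {\<omega> \<in> space M. \<bar>Z \<omega>\<bar> > t} = 0"
        by (subst prob_eq_0) auto
      then show ?thesis using K0 by (simp add: tail_rhs_def)
    next
      case False
      then have k: "0 < k" using real by simp
      \<comment> \<open>A scale below twice the norm exists because the norm is positive; this is
        the 2 in \<open>(2 * conc_const \<alpha>) powr \<alpha>\<close>.\<close>
      then have "orlicz_norm \<alpha> M (max_abs n X) < ennreal (2 * k)"
        using real unfolding K_def[symmetric] by (simp add: ennreal_less_iff)
      then obtain s where s: "orlicz_bound \<alpha> M (max_abs n X) s" "ennreal s < ennreal (2 * k)"
        by (rule orlicz_norm_lessD)
      then have sk: "0 < s" "s < 2 * k" by (auto simp: orlicz_bound_def ennreal_less_iff)
      have "prob {\<omega> \<in> space M. \<bar>Z \<omega>\<bar> > t} \<le> 2 * exp (- ((t / (C * s)) powr \<alpha>))"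
        using orlicz_bound_centered[OF adm \<alpha> s(1)] t \<alpha>
        unfolding Z_def[symmetric] C_def[symmetric] by (intro orlicz_bound_tail) auto
      also have "\<dots> \<le> 2 * exp (- ((t / (2 * C * k)) powr \<alpha>))"
      proof -
        have "t / (2 * C * k) \<le> t / (C * s)"
          using t C sk k by (intro divide_left_mono) auto
        then have "(t / (2 * C * k)) powr \<alpha> \<le> (t / (C * s)) powr \<alpha>"
          using t C k \<alpha> by (intro powr_mono2) auto
        then show ?thesis by simp
      qed
      also have "(t / (2 * C * k)) powr \<alpha> = t powr \<alpha> / ((2 * C) powr \<alpha> * enn2real K powr \<alpha>)"
        using t C k real by (simp add: powr_divide powr_mult)
      finally show ?thesis using k real by (simp add: tail_rhs_def)
    qed
  qed
  then show "prob {\<omega> \<in> space M. \<bar>centered M (\<lambda>\<omega>'. f (random_vector n X \<omega>')) \<omega>\<bar> > t}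
      \<le> tail_rhs \<alpha> ((2 * conc_const \<alpha>) powr \<alpha>) (orlicz_norm \<alpha> M (max_abs n X)) t"
    by (simp add: Z_def K_def C_def)
qed

lemma orlicz_norm_distr:
  assumes "T \<in> measurable M N" "Y \<in> borel_measurable N"
  shows "orlicz_norm \<alpha> (distr M N T) Y = orlicz_norm \<alpha> M (\<lambda>\<omega>. Y (T \<omega>))"
  using assms unfolding orlicz_norm_def by (simp add: nn_integral_distr)

section \<open>Independence of the sample space\<close>

text \<open>Admissible data may be replaced by the canonical ones, the coordinate functions on
  \<open>nat \<Rightarrow> real\<close> under the law of the random vector.\<close>

locale canonical_version =
  fixes \<alpha> :: real and M :: "'a measure" and n :: nat and X f
  assumes adm: "admissible \<alpha> M n X f"
begin

definition N :: "(nat \<Rightarrow> real) measure" where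
  "N = distr M (PiM {..<n} (\<lambda>_. borel)) (random_vector n X)"

definition X' :: "nat \<Rightarrow> (nat \<Rightarrow> real) \<Rightarrow> real" where
  "X' i x = x i"

definition Z' :: "(nat \<Rightarrow> real) \<Rightarrow> real" where
  "Z' = centered N (\<lambda>x. f (random_vector n X' x))"

lemmas meas [measurable] = admissible_measurable[OF adm]

lemma sets_N [measurable_cong]: "sets N = sets (PiM {..<n} (\<lambda>_. borel))"
  by (simp add: N_def)

lemma random_vector_X':
  "x \<in> space N \<Longrightarrow> random_vector n X' x = x"
  "random_vector n X' (random_vector n X \<omega>) = random_vector n X \<omega>"
  by (auto simp: N_def random_vector_def X'_def space_PiM PiE_def extensional_restrict)

lemma measurable_X' [measurable]: "i < n \<Longrightarrow> X' i \<in> borel_measurable (PiM {..<n} (\<lambda>_. borel))"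
  unfolding X'_def[abs_def] by simp

lemma X'_random_vector: "i < n \<Longrightarrow> X' i (random_vector n X \<omega>) = X i \<omega>"
  by (simp add: X'_def random_vector_def)

text \<open>Independence means that the law \<open>N\<close> of the random vector is the product of
  its marginals, which are also the laws of the coordinate functions under \<open>N\<close>.\<close>

lemma admissible_canonical: "admissible \<alpha> N n X' f"
proof -
  interpret M: prob_space M using adm by (simp add: admissible_def)
  interpret N: prob_space N unfolding N_def by (rule M.prob_space_distr) measurable
  have n: "{..<n} \<noteq> {}" using adm by (auto simp: admissible_def lessThan_empty_iff)
  have marg: "distr N borel (X' i) = distr M borel (X i)" if "i < n" for i
    unfolding N_def using that
    by (subst distr_distr) (auto simp: comp_def X'_random_vector intro!: distr_cong)
  have "distr N (PiM {..<n} (\<lambda>_. borel)) (\<lambda>x. \<lambda>i\<in>{..<n}. X' i x) = N"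
  proof -
    \<comment> \<open>Points of the space of \<open>N\<close> are extensional, so collecting their
      coordinates again gives the identity.\<close>
    have "distr N (PiM {..<n} (\<lambda>_. borel)) (\<lambda>x. \<lambda>i\<in>{..<n}. X' i x)
        = distr N N (\<lambda>x. x)"
      using random_vector_X'(1) by (intro distr_cong) (auto simp: sets_N random_vector_def)
    then show ?thesis by (simp add: distr_id)
  qed
  also have "N = PiM {..<n} (\<lambda>i. distr M borel (X i))"
    using adm n unfolding N_def random_vector_def[abs_def] admissible_def
    by (subst M.indep_vars_iff_distr_eq_PiM'[symmetric]) auto
  also have "\<dots> = PiM {..<n} (\<lambda>i. distr N borel (X' i))"
    by (intro PiM_cong) (auto simp: marg)
  finally have indep: "N.indep_vars (\<lambda>_. borel) X' {..<n}"
    using n by (subst N.indep_vars_iff_distr_eq_PiM') auto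
  have "orlicz_norm \<alpha> N (X' i) = orlicz_norm \<alpha> M (X i)" if "i < n" for i
    unfolding N_def using that
    by (subst orlicz_norm_distr) (auto simp: X'_random_vector)
  then show ?thesis
    using adm indep N.prob_space_axioms by (simp add: admissible_def)
qed

lemma centered_canonical:
  "Z' (random_vector n X \<omega>) = centered M (\<lambda>\<omega>. f (random_vector n X \<omega>)) \<omega>"
proof -
  have "(\<integral>x. f (random_vector n X' x) \<partial>N) = (\<integral>x. f x \<partial>N)"
    by (intro Bochner_Integration.integral_cong refl) (simp add: random_vector_X')
  also have "\<dots> = (\<integral>\<omega>. f (random_vector n X \<omega>) \<partial>M)"
    unfolding N_def by (rule integral_distr) measurable
  finally show ?thesis by (simp add: Z'_def centered_def random_vector_X')
qed

lemma measurable_Z' [measurable]: "Z' \<in> borel_measurable (PiM {..<n} (\<lambda>_. borel))"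
proof -
  have "random_vector n X' \<in> measurable (PiM {..<n} (\<lambda>_. borel)) (PiM {..<n} (\<lambda>_. borel))"
    unfolding random_vector_def[abs_def] by (intro measurable_restrict) auto
  from measurable_compose[OF this meas(3)] show ?thesis
    unfolding Z'_def centered_def[abs_def] by measurable
qed

lemma orlicz_norm_centered_canonical:
  "orlicz_norm \<alpha> N Z' = orlicz_norm \<alpha> M (centered M (\<lambda>\<omega>. f (random_vector n X \<omega>)))"
  unfolding N_def by (subst orlicz_norm_distr) (auto simp: centered_canonical)

lemma orlicz_norm_max_canonical:
  "orlicz_norm \<alpha> N (max_abs n X') = orlicz_norm \<alpha> M (max_abs n X)"
proof -
  have "max_abs n X' (random_vector n X \<omega>) = max_abs n X \<omega>" for \<omega>
    unfolding max_abs_def by (intro arg_cong[of _ _ Max] image_cong refl) (simp add: X'_random_vector)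
  moreover have "max_abs n X' \<in> borel_measurable (PiM {..<n} (\<lambda>_. borel))" by measurable
  ultimately show ?thesis
    unfolding N_def by (subst orlicz_norm_distr) (auto simp: meas)
qed

lemma tail_canonical:
  "measure N {x \<in> space N. \<bar>Z' x\<bar> > t} =
   measure M {\<omega> \<in> space M. \<bar>centered M (\<lambda>\<omega>. f (random_vector n X \<omega>)) \<omega>\<bar> > t}"
proof -
  have "{x \<in> space N. \<bar>Z' x\<bar> > t} \<in> sets (PiM {..<n} (\<lambda>_. borel))"
    unfolding N_def by simp
  then have "measure N {x \<in> space N. \<bar>Z' x\<bar> > t} =
      measure M (random_vector n X -` {x \<in> space N. \<bar>Z' x\<bar> > t} \<inter> space M)"
    unfolding N_def by (intro measure_distr meas) simp
  also have "random_vector n X -` {x \<in> space N. \<bar>Z' x\<bar> > t} \<inter> space M =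
      {\<omega> \<in> space M. \<bar>centered M (\<lambda>\<omega>. f (random_vector n X \<omega>)) \<omega>\<bar> > t}"
    using measurable_space[OF meas(2)] by (auto simp: centered_canonical N_def)
  finally show ?thesis .
qed

end

lemma tail_constant_transfer:
  assumes "tail_constant TYPE(nat \<Rightarrow> real) \<alpha> C"
  shows "tail_constant TYPE('a) \<alpha> C"
  unfolding tail_constant_def
proof (intro allI impI)
  fix M :: "'a measure" and n X f and t :: real
  assume adm: "admissible \<alpha> M n X f" and t: "0 \<le> t"
  interpret canonical_version \<alpha> M n X f by unfold_locales (rule adm)
  have "measure N {x \<in> space N. \<bar>Z' x\<bar> > t} \<le> tail_rhs \<alpha> C (orlicz_norm \<alpha> N (max_abs n X')) t"
    using assms admissible_canonical t unfolding tail_constant_def Z'_def by blast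
  then show "measure M {\<omega> \<in> space M. \<bar>centered M (\<lambda>\<omega>'. f (random_vector n X \<omega>')) \<omega>\<bar> > t}
      \<le> tail_rhs \<alpha> C (orlicz_norm \<alpha> M (max_abs n X)) t"
    unfolding tail_canonical orlicz_norm_max_canonical .
qed

lemma norm_constant_transfer:
  assumes "norm_constant TYPE(nat \<Rightarrow> real) \<alpha> C"
  shows "norm_constant TYPE('a) \<alpha> C"
  unfolding norm_constant_def
proof (intro allI impI)
  fix M :: "'a measure" and n X f
  assume adm: "admissible \<alpha> M n X f"
  interpret canonical_version \<alpha> M n X f by unfold_locales (rule adm)
  have "orlicz_norm \<alpha> N Z' \<le> ennreal C * orlicz_norm \<alpha> N (max_abs n X')"
    using assms admissible_canonical unfolding norm_constant_def Z'_def by blast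
  then show "orlicz_norm \<alpha> M (centered M (\<lambda>\<omega>. f (random_vector n X \<omega>)))
      \<le> ennreal C * orlicz_norm \<alpha> M (max_abs n X)"
    unfolding orlicz_norm_centered_canonical orlicz_norm_max_canonical .
qed

theorem proposition3p1:
  fixes \<alpha> :: real
  assumes "0 < \<alpha>" and "\<alpha> \<le> 2"
  shows "((\<exists>C>0. tail_constant TYPE(nat \<Rightarrow> real) \<alpha> C) \<and>
          (\<forall>C>0. tail_constant TYPE(nat \<Rightarrow> real) \<alpha> C \<longrightarrow> tail_constant TYPE('a) \<alpha> C)) \<and>
         ((\<exists>C>0. norm_constant TYPE(nat \<Rightarrow> real) \<alpha> C) \<and>
          (\<forall>C>0. norm_constant TYPE(nat \<Rightarrow> real) \<alpha> C \<longrightarrow> norm_constant TYPE('a) \<alpha> C))"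
proof (intro conjI allI impI)
  have "0 < (2 * conc_const \<alpha>) powr \<alpha>" using conc_const_pos[of \<alpha>] by simp
  then show "\<exists>C>0. tail_constant TYPE(nat \<Rightarrow> real) \<alpha> C"
    using tail_constant_conc_const[OF assms] by blast
  show "\<exists>C>0. norm_constant TYPE(nat \<Rightarrow> real) \<alpha> C"
    using norm_constant_conc_const[OF assms] conc_const_pos by blast
qed (auto intro: tail_constant_transfer norm_constant_transfer)

end
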